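(* Let $n\ge3$. The operator $M_{\mathrm{inv}}$ on $\mathbb C[\mathfrak S_n]$ has exactly three nonzero eigenvalues $s_0^{\mathrm{inv}}>0$ and $s_1^{\mathrm{inv}},s_2^{\mathrm{inv}}<0$, where $$s_0^{\mathrm{inv}}=n!\cdot\frac{n(n-1)}4,\qquad s_1^{\mathrm{inv}}=-\frac{(n+1)!}6,\qquad s_2^{\mathrm{inv}}=-\frac{n!}6.$$ The eigenspace corresponding to $s_0^{\mathrm{inv}}$ is one-dimensional and coincides with the subspace of constants $\mathbb C\cdot\sum_{\sigma\in\mathfrak S_n}\sigma$. The eigenspace corresponding to $s_1^{\mathrm{inv}}$ has dimension $n-1$ and coincides with $H_1=C_1\mathcal H$. The eigenspace corresponding to $s_2^{\mathrm{inv}}$ has dimension $\frac{(n-1)(n-2)}2$ and coincides with $H_2=C_2\mathcal H$.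
   Context: $\mathfrak S_n$ is the symmetric group on $\{1,\dots,n\}$, with products taken left to right: $(\sigma\tau)(i)=\tau(\sigma(i))$. For $\sigma\in\mathfrak S_n$, $\mathrm{inv}(\sigma)=\#\{i<j:\sigma(i)>\sigma(j)\}$; $u_{\mathrm{inv}}=\sum_{g\in\mathfrak S_n}\mathrm{inv}(g)g\in\mathbb C[\mathfrak S_n]$, and $M_{\mathrm{inv}}$ is the operator of right multiplication by $u_{\mathrm{inv}}$ in $\mathbb C[\mathfrak S_n]$: $M_{\mathrm{inv}}f=fu_{\mathrm{inv}}$, i.e. $(M_{\mathrm{inv}}f)(\sigma)=\sum_{g\in\mathfrak S_n}f(g)\,\mathrm{inv}(g^{-1}\sigma)$. For $1\le i<j\le n$ let $e_{ij}=\frac1{\sqrt{n!}}\sum_{\sigma\in\mathfrak S_n}\varepsilon_{ij}(\sigma)\sigma$, where $\varepsilon_{ij}(\sigma)=1$ if $\sigma(i)<\sigma(j)$ and $-1$ if $\sigma(i)>\sigma(j)$; $\mathcal H$ is the linear span of the $e_{ij}$ in $\mathbb C[\mathfrak S_n]$. $C_1$ and $C_2$ are the (primitive) central idempotents in $\mathbb C[\mathfrak S_n]$ corresponding to the irreducible representations with Young diagrams $(n-1,1)$ and $(n-2,1^2)$, respectively. *)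

theory Defs
  imports Complex_Main "HOL-Library.Function_Algebras" "HOL-Combinatorics.Permutations"
begin

text \<open>
  Elements of \<open>\<complex>[S\<^sub>n]\<close> are functions \<open>f :: (nat \<Rightarrow> nat) \<Rightarrow> complex\<close> vanishing outside the
  permutations of \<open>{1..n}\<close>; \<open>f\<close> stands for the formal sum of the \<open>f \<sigma> \<cdot> \<sigma>\<close>. Addition is the
  pointwise one of \<^theory>\<open>HOL-Library.Function_Algebras\<close>. The pointwise product of that
  theory is never used: the algebra product is \<open>alg_mult\<close>.
\<close>

type_synonym perm_fun = "(nat \<Rightarrow> nat) \<Rightarrow> complex"

definition Sym :: "nat \<Rightarrow> (nat \<Rightarrow> nat) set" where
  "Sym n = {\<sigma>. \<sigma> permutes {1..n}}"

definition alg_carrier :: "nat \<Rightarrow> perm_fun set" where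
  "alg_carrier n = {f. \<forall>\<sigma>. \<sigma> \<notin> Sym n \<longrightarrow> f \<sigma> = 0}"

definition alg_scale :: "complex \<Rightarrow> perm_fun \<Rightarrow> perm_fun" where
  "alg_scale c f = (\<lambda>\<sigma>. c * f \<sigma>)"

interpretation alg: vector_space alg_scale
  by unfold_locales (auto simp: alg_scale_def fun_eq_iff algebra_simps)

definition alg_elt :: "(nat \<Rightarrow> nat) \<Rightarrow> perm_fun" where
  "alg_elt \<sigma> = (\<lambda>\<tau>. if \<tau> = \<sigma> then 1 else 0)"

text \<open>
  Permutations are multiplied left to right, so the group product \<open>\<sigma>\<tau>\<close> is \<open>\<tau> \<circ> \<sigma>\<close>, and
  \<open>g\<^sup>-\<^sup>1\<sigma>\<close> is \<open>\<sigma> \<circ> inv g\<close>; see \<open>alg_mult_elt\<close> below.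
\<close>

definition alg_mult :: "nat \<Rightarrow> perm_fun \<Rightarrow> perm_fun \<Rightarrow> perm_fun" where
  "alg_mult n f h = (\<lambda>\<sigma>. if \<sigma> \<in> Sym n then (\<Sum>g\<in>Sym n. f g * h (\<sigma> \<circ> inv g)) else 0)"

lemma alg_mult_elt:
  assumes "\<sigma> \<in> Sym n" "\<tau> \<in> Sym n"
  shows "alg_mult n (alg_elt \<sigma>) (alg_elt \<tau>) = alg_elt (\<tau> \<circ> \<sigma>)"
proof
  fix \<rho>
  have fin: "finite (Sym n)"
    unfolding Sym_def by (rule finite_permutations) simp
  have iff: "\<rho> \<circ> inv \<sigma> = \<tau> \<longleftrightarrow> \<rho> = \<tau> \<circ> \<sigma>"
    using assms(1) permutes_inv_o[of \<sigma> "{1..n}"] by (auto simp: Sym_def o_assoc[symmetric])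
  have mem: "\<tau> \<circ> \<sigma> \<in> Sym n"
    using assms by (auto simp: Sym_def intro: permutes_compose)
  have "(\<Sum>g\<in>Sym n. alg_elt \<sigma> g * alg_elt \<tau> (\<rho> \<circ> inv g)) =
        (\<Sum>g\<in>Sym n. if g = \<sigma> then alg_elt \<tau> (\<rho> \<circ> inv \<sigma>) else 0)"
    by (rule sum.cong) (auto simp: alg_elt_def)
  also have "\<dots> = alg_elt \<tau> (\<rho> \<circ> inv \<sigma>)"
    using assms(1) fin by simp
  finally show "alg_mult n (alg_elt \<sigma>) (alg_elt \<tau>) \<rho> = alg_elt (\<tau> \<circ> \<sigma>) \<rho>"
    using iff mem by (auto simp: alg_mult_def alg_elt_def)
qed

definition inversions :: "nat \<Rightarrow> (nat \<Rightarrow> nat) \<Rightarrow> nat" where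
  "inversions n \<sigma> = card {(i, j). 1 \<le> i \<and> i < j \<and> j \<le> n \<and> \<sigma> i > \<sigma> j}"

definition u_inv :: "nat \<Rightarrow> perm_fun" where
  "u_inv n = (\<Sum>g\<in>Sym n. alg_scale (of_nat (inversions n g)) (alg_elt g))"

definition M_inv :: "nat \<Rightarrow> perm_fun \<Rightarrow> perm_fun" where
  "M_inv n f = alg_mult n f (u_inv n)"

definition eigenspace :: "nat \<Rightarrow> (perm_fun \<Rightarrow> perm_fun) \<Rightarrow> complex \<Rightarrow> perm_fun set" where
  "eigenspace n T c = {f \<in> alg_carrier n. T f = alg_scale c f}"

definition is_eigenvalue :: "nat \<Rightarrow> (perm_fun \<Rightarrow> perm_fun) \<Rightarrow> complex \<Rightarrow> bool" where
  "is_eigenvalue n T c \<longleftrightarrow> (\<exists>f \<in> alg_carrier n. f \<noteq> 0 \<and> T f = alg_scale c f)"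

definition eps :: "nat \<Rightarrow> nat \<Rightarrow> (nat \<Rightarrow> nat) \<Rightarrow> complex" where
  "eps i j \<sigma> = (if \<sigma> i < \<sigma> j then 1 else -1)"

definition e_vec :: "nat \<Rightarrow> nat \<Rightarrow> nat \<Rightarrow> perm_fun" where
  "e_vec n i j =
     alg_scale (1 / complex_of_real (sqrt (fact n))) (\<Sum>\<sigma>\<in>Sym n. alg_scale (eps i j \<sigma>) (alg_elt \<sigma>))"

definition H_space :: "nat \<Rightarrow> perm_fun set" where
  "H_space n = alg.span {e_vec n i j | i j. 1 \<le> i \<and> i < j \<and> j \<le> n}"

text \<open>
  A Young diagram is given by the list \<open>\<mu>\<close> of its row lengths. The canonical tableau of shape
  \<open>\<mu>\<close> is filled with \<open>1, \<dots>, n\<close> row by row; \<open>tab_row \<mu> k\<close> (counted from 0) and \<open>tab_col \<mu> k\<close>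
  (counted from 1) give the position of \<open>k\<close>.
\<close>

definition tab_row :: "nat list \<Rightarrow> nat \<Rightarrow> nat" where
  "tab_row \<mu> k = (LEAST r. k \<le> sum_list (take (Suc r) \<mu>))"

definition tab_col :: "nat list \<Rightarrow> nat \<Rightarrow> nat" where
  "tab_col \<mu> k = k - sum_list (take (tab_row \<mu> k) \<mu>)"

definition row_group :: "nat \<Rightarrow> nat list \<Rightarrow> (nat \<Rightarrow> nat) set" where
  "row_group n \<mu> = {\<sigma> \<in> Sym n. \<forall>k\<in>{1..n}. tab_row \<mu> (\<sigma> k) = tab_row \<mu> k}"

definition col_group :: "nat \<Rightarrow> nat list \<Rightarrow> (nat \<Rightarrow> nat) set" where
  "col_group n \<mu> = {\<sigma> \<in> Sym n. \<forall>k\<in>{1..n}. tab_col \<mu> (\<sigma> k) = tab_col \<mu> k}"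

definition young_symmetrizer :: "nat \<Rightarrow> nat list \<Rightarrow> perm_fun" where
  "young_symmetrizer n \<mu> =
     alg_mult n (\<Sum>\<sigma>\<in>row_group n \<mu>. alg_elt \<sigma>)
                (\<Sum>\<sigma>\<in>col_group n \<mu>. alg_scale (of_int (sign \<sigma>)) (alg_elt \<sigma>))"

text \<open>
  The irreducible representation with diagram \<open>\<mu>\<close> is realised as the left ideal generated by
  the Young symmetrizer.
\<close>

definition irrep :: "nat \<Rightarrow> nat list \<Rightarrow> perm_fun set" where
  "irrep n \<mu> = {alg_mult n f (young_symmetrizer n \<mu>) | f. f \<in> alg_carrier n}"

definition central_idempotent :: "nat \<Rightarrow> perm_fun \<Rightarrow> bool" where
  "central_idempotent n z \<longleftrightarrow>
     z \<in> alg_carrier n \<and> (\<forall>f \<in> alg_carrier n. alg_mult n z f = alg_mult n f z) \<and> alg_mult n z z = z"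

definition primitive_central_idempotent :: "nat \<Rightarrow> perm_fun \<Rightarrow> bool" where
  "primitive_central_idempotent n z \<longleftrightarrow>
     central_idempotent n z \<and> z \<noteq> 0 \<and>
     (\<forall>p q. central_idempotent n p \<and> central_idempotent n q \<and> alg_mult n p q = 0 \<and> z = p + q
        \<longrightarrow> p = 0 \<or> q = 0)"

text \<open>
  A primitive central idempotent acts as the identity on exactly one irreducible representation
  and as zero on the others; this is the one attached to the diagram \<open>\<mu>\<close>.
\<close>

definition diagram_idempotent :: "nat \<Rightarrow> nat list \<Rightarrow> perm_fun" where
  "diagram_idempotent n \<mu> =
     (THE z. primitive_central_idempotent n z \<and> (\<forall>v \<in> irrep n \<mu>. alg_mult n z v = v))"

definition C1 :: "nat \<Rightarrow> perm_fun" where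
  "C1 n = diagram_idempotent n [n - 1, 1]"

definition C2 :: "nat \<Rightarrow> perm_fun" where
  "C2 n = diagram_idempotent n [n - 2, 1, 1]"

definition H1 :: "nat \<Rightarrow> perm_fun set" where
  "H1 n = alg_mult n (C1 n) ` H_space n"

definition H2 :: "nat \<Rightarrow> perm_fun set" where
  "H2 n = alg_mult n (C2 n) ` H_space n"

end

(*
  The kernel inv(g^-1 s) is n(n-1)/4 minus one quarter of the sum over all a, b of
  eps_ab(g) eps_ab(s), where e_ba = - e_ab, so the range of M_inv lies in the span of the constants
  and the e_ab. The Gram matrix of the e_ab involves just the values 0, 1, -1, 1/3, -1/3; with
  r_k = sum_b e_kb it gives
  M_inv e_kl = -(n!/6) (e_kl + r_k - r_l). Hence the r_k span the eigenspace of s1, the vectors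
  e_kl - (r_k - r_l)/n the one of s2, and both dimensions follow from the independence of the e_kl.

  For a hook diagram with Young symmetrizer y, elements invariant under the row group on the left
  and alternating under the column group on the right are multiples of y. Therefore a multiple of the
  class sum of y is a central idempotent that fixes y, and it is primitive since every central
  element acts on y as a scalar. The vectors r_n and e_{n-1,n} - (r_{n-1} - r_n)/n lie in the right ideals
  generated by the two Young symmetrizers, and y_1 A y_2 = 0 because a row of length n - 1 always
  meets a column of length 3 in two points. So C_1 fixes the first eigenspace and kills the second,
  and C_2 does the opposite.
*)
theory Submission
  imports Defs
begin

text \<open>No representation theory enters. The idempotents are given by a definite description, so
  a candidate has to be exhibited and every competitor identified with it. Both reduce to how
  central elements act on one Young symmetrizer, with one-dimensionality in the role of Schur's
  lemma. The shape matters: a hook is a row and a column sharing one cell, so whether a permutation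
  factors into a column part and a row part is a pigeonhole count. The delicate point is the
  normalisation, since a priori the class sum of \<open>y\<close> might be nilpotent; positivity of
  a sum of squares excludes this. Products read left to right, so left multiplication relabels the
  indices of the e_ij, while the operator, a right multiplication, commutes with it. Hence one
  vector of each eigenspace, written as a Young symmetrizer times something, decides how a central
  element acts on the whole eigenspace.\<close>

abbreviation vscale :: "complex \<Rightarrow> perm_fun \<Rightarrow> perm_fun" (infixr "\<cdot>" 75)
  where "c \<cdot> f \<equiv> alg_scale c f"

section \<open>Pointwise evaluation, and composition in the symmetric group\<close>

lemma sum_perm_fun_apply: "(\<Sum>i\<in>I. F i :: perm_fun) x = (\<Sum>i\<in>I. F i x)"
  by (induction I rule: infinite_finite_induct) auto

lemma minus_perm_fun_apply: "(f - h :: perm_fun) x = f x - h x"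
  by (simp add: fun_diff_def)

lemma uminus_perm_fun_apply: "(- f :: perm_fun) x = - f x"
  by (simp add: fun_Compl_def)

lemmas perm_fun_apply = sum_perm_fun_apply minus_perm_fun_apply uminus_perm_fun_apply

lemma scale_apply: "(c \<cdot> f) x = c * f x"
  by (simp add: alg_scale_def)

lemma finite_Sym [simp]: "finite (Sym n)"
  unfolding Sym_def by (rule finite_permutations) simp

lemma card_Sym: "card (Sym n) = fact n"
  unfolding Sym_def by (simp add: card_permutations)

lemma Sym_id [simp]: "id \<in> Sym n"
  by (simp add: Sym_def permutes_id)

lemma Sym_comp [simp]: "f \<in> Sym n \<Longrightarrow> h \<in> Sym n \<Longrightarrow> f \<circ> h \<in> Sym n"
  by (simp add: Sym_def permutes_compose)

lemma Sym_inv [simp]: "f \<in> Sym n \<Longrightarrow> inv f \<in> Sym n"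
  by (simp add: Sym_def permutes_inv)

lemma Sym_inv_inv [simp]: "f \<in> Sym n \<Longrightarrow> inv (inv f) = f"
  by (auto simp: Sym_def permutes_inv_inv)

lemma Sym_inv_comp: "f \<in> Sym n \<Longrightarrow> h \<in> Sym n \<Longrightarrow> inv (f \<circ> h) = inv h \<circ> inv f"
  by (simp add: Sym_def o_inv_distrib permutes_bij)

lemma Sym_inv_o [simp]:
  assumes "f \<in> Sym n"
  shows "inv f \<circ> f = id" "f \<circ> inv f = id" "inv f (f x) = x" "f (inv f x) = x"
    "inv f \<circ> (f \<circ> k) = k" "f \<circ> (inv f \<circ> k) = k" "k \<circ> inv f \<circ> f = k" "k \<circ> f \<circ> inv f = k"
  using assms by (auto simp: Sym_def permutes_inv_o permutes_inverses o_assoc simp flip: o_assoc)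

lemma Sym_subset: "r permutes P \<Longrightarrow> P \<subseteq> {1..n} \<Longrightarrow> r \<in> Sym n"
  by (auto simp: Sym_def intro: permutes_subset)

lemma Sym_in_range: "f \<in> Sym n \<Longrightarrow> f x \<in> {1..n} \<longleftrightarrow> x \<in> {1..n}"
  unfolding Sym_def by (metis mem_Collect_eq permutes_in_image)

lemma Sym_inj: "f \<in> Sym n \<Longrightarrow> f x = f y \<longleftrightarrow> x = y"
  by (auto simp: Sym_def dest: permutes_inj injD)

lemma Sym_transpose: "a \<in> {1..n} \<Longrightarrow> b \<in> {1..n} \<Longrightarrow> transpose a b \<in> Sym n"
  by (simp add: Sym_def permutes_swap_id)

lemma sum_Sym_comp_right: "h \<in> Sym n \<Longrightarrow> (\<Sum>g\<in>Sym n. F (g \<circ> h)) = (\<Sum>g\<in>Sym n. F g)"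
  by (rule sum.reindex_bij_witness[of _ "\<lambda>g. g \<circ> inv h" "\<lambda>g. g \<circ> h"]) auto

lemma sum_Sym_comp_left: "h \<in> Sym n \<Longrightarrow> (\<Sum>g\<in>Sym n. F (h \<circ> g)) = (\<Sum>g\<in>Sym n. F g)"
  by (rule sum.reindex_bij_witness[of _ "\<lambda>g. inv h \<circ> g" "\<lambda>g. h \<circ> g"]) auto

lemma of_int_sign_mult_self [simp]: "of_int (sign k) * (of_int (sign k) :: complex) = 1"
  by (cases k rule: sign_cases) auto

lemma sign_permutes_comp:
  "finite Q \<Longrightarrow> k permutes Q \<Longrightarrow> l permutes Q \<Longrightarrow> sign (k \<circ> l) = sign k * sign l"
  by (meson permutes_imp_permutation sign_compose)

lemma sign_permutes_inv: "finite Q \<Longrightarrow> k permutes Q \<Longrightarrow> sign (inv k) = sign k"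
  by (meson permutes_imp_permutation sign_inverse)

section \<open>The group algebra\<close>

context
  fixes n :: nat
begin

abbreviation gmult :: "perm_fun \<Rightarrow> perm_fun \<Rightarrow> perm_fun" (infixl "\<star>" 70)
  where "f \<star> h \<equiv> alg_mult n f h"

lemma gmult_assoc: "f \<star> h \<star> k = f \<star> (h \<star> k)"
proof
  fix \<sigma>
  show "(f \<star> h \<star> k) \<sigma> = (f \<star> (h \<star> k)) \<sigma>"
  proof (cases "\<sigma> \<in> Sym n")
    case True
    have "(f \<star> h \<star> k) \<sigma> = (\<Sum>g\<in>Sym n. \<Sum>p\<in>Sym n. f p * h (g \<circ> inv p) * k (\<sigma> \<circ> inv g))"
      using True by (simp add: alg_mult_def sum_distrib_right)
    also have "\<dots> = (\<Sum>p\<in>Sym n. \<Sum>g\<in>Sym n. f p * h (g \<circ> inv p) * k (\<sigma> \<circ> inv g))"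
      by (rule sum.swap)
    also have "\<dots> = (\<Sum>p\<in>Sym n. \<Sum>g\<in>Sym n. f p * (h g * k (\<sigma> \<circ> inv p \<circ> inv g)))"
    proof (rule sum.cong[OF refl])
      fix p assume p: "p \<in> Sym n"
      have "(\<Sum>g\<in>Sym n. f p * h (g \<circ> inv p) * k (\<sigma> \<circ> inv g)) =
        (\<Sum>g\<in>Sym n. f p * h (g \<circ> p \<circ> inv p) * k (\<sigma> \<circ> inv (g \<circ> p)))"
        using sum_Sym_comp_right[OF p, of "\<lambda>g. f p * h (g \<circ> inv p) * k (\<sigma> \<circ> inv g)"] by simp
      also have "\<dots> = (\<Sum>g\<in>Sym n. f p * (h g * k (\<sigma> \<circ> inv p \<circ> inv g)))"
        using p by (intro sum.cong) (auto simp: Sym_inv_comp o_assoc)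
      finally show "(\<Sum>g\<in>Sym n. f p * h (g \<circ> inv p) * k (\<sigma> \<circ> inv g)) =
        (\<Sum>g\<in>Sym n. f p * (h g * k (\<sigma> \<circ> inv p \<circ> inv g)))" .
    qed
    also have "\<dots> = (f \<star> (h \<star> k)) \<sigma>"
      using True by (simp add: alg_mult_def sum_distrib_left)
    finally show ?thesis .
  qed (simp add: alg_mult_def)
qed

lemma gmult_carrier [simp]: "f \<star> h \<in> alg_carrier n"
  by (simp add: alg_carrier_def alg_mult_def)

lemma elt_carrier [simp]: "\<sigma> \<in> Sym n \<Longrightarrow> alg_elt \<sigma> \<in> alg_carrier n"
  by (auto simp: alg_carrier_def alg_elt_def)

lemma gmult_add_left: "(f + h) \<star> k = f \<star> k + h \<star> k"
  by (auto simp: alg_mult_def fun_eq_iff algebra_simps sum.distrib)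

lemma gmult_add_right: "k \<star> (f + h) = k \<star> f + k \<star> h"
  by (auto simp: alg_mult_def fun_eq_iff algebra_simps sum.distrib)

lemma gmult_diff_left: "(f - h) \<star> k = f \<star> k - h \<star> k"
  by (auto simp: alg_mult_def fun_eq_iff algebra_simps sum_subtractf perm_fun_apply)

lemma gmult_diff_right: "k \<star> (f - h) = k \<star> f - k \<star> h"
  by (auto simp: alg_mult_def fun_eq_iff algebra_simps sum_subtractf perm_fun_apply)

lemma gmult_scale_left: "(c \<cdot> f) \<star> h = c \<cdot> (f \<star> h)"
  by (auto simp: alg_mult_def alg_scale_def fun_eq_iff sum_distrib_left algebra_simps)

lemma gmult_scale_right: "f \<star> (c \<cdot> h) = c \<cdot> (f \<star> h)"
  by (auto simp: alg_mult_def alg_scale_def fun_eq_iff sum_distrib_left algebra_simps)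

lemma gmult_zero [simp]: "0 \<star> f = 0" "f \<star> 0 = 0"
  by (auto simp: alg_mult_def fun_eq_iff)

lemma gmult_sum_left: "(\<Sum>i\<in>I. F i) \<star> h = (\<Sum>i\<in>I. F i \<star> h)"
  by (auto simp: alg_mult_def fun_eq_iff perm_fun_apply sum_distrib_right intro: sum.swap)

lemma gmult_sum_right: "h \<star> (\<Sum>i\<in>I. F i) = (\<Sum>i\<in>I. h \<star> F i)"
  by (auto simp: alg_mult_def fun_eq_iff perm_fun_apply sum_distrib_left intro: sum.swap)

lemmas gmult_linear = gmult_add_left gmult_add_right gmult_diff_left gmult_diff_right
  gmult_scale_left gmult_scale_right gmult_sum_left gmult_sum_right

text \<open>Since \<sigma>\<tau> is \<open>\<tau> \<circ> \<sigma>\<close>, left multiplication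
  translates the argument from the right, that is, it acts on positions;
  \<open>gmult_elt_apply\<close> is the mirror image, acting on values.\<close>

lemma elt_gmult_apply:
  assumes "\<tau> \<in> Sym n" "\<sigma> \<in> Sym n"
  shows "(alg_elt \<tau> \<star> f) \<sigma> = f (\<sigma> \<circ> inv \<tau>)"
proof -
  have "(alg_elt \<tau> \<star> f) \<sigma> = (\<Sum>g\<in>Sym n. alg_elt \<tau> g * f (\<sigma> \<circ> inv g))"
    using assms by (simp add: alg_mult_def)
  also have "\<dots> = (\<Sum>g\<in>Sym n. if g = \<tau> then f (\<sigma> \<circ> inv \<tau>) else 0)"
    by (rule sum.cong) (auto simp: alg_elt_def)
  finally show ?thesis using assms by simp
qed

lemma gmult_elt_apply:
  assumes "\<tau> \<in> Sym n" "\<sigma> \<in> Sym n"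
  shows "(f \<star> alg_elt \<tau>) \<sigma> = f (inv \<tau> \<circ> \<sigma>)"
proof -
  have "\<sigma> \<circ> inv g = \<tau> \<longleftrightarrow> g = inv \<tau> \<circ> \<sigma>" if g: "g \<in> Sym n" for g
  proof
    assume "\<sigma> \<circ> inv g = \<tau>"
    then have "\<tau> \<circ> g = \<sigma>" using g by auto
    then show "g = inv \<tau> \<circ> \<sigma>" using assms by auto
  next
    assume "g = inv \<tau> \<circ> \<sigma>"
    then show "\<sigma> \<circ> inv g = \<tau>" using assms by (simp add: Sym_inv_comp[OF Sym_inv])
  qed
  then have "(\<Sum>g\<in>Sym n. f g * alg_elt \<tau> (\<sigma> \<circ> inv g)) =
      (\<Sum>g\<in>Sym n. if g = inv \<tau> \<circ> \<sigma> then f g else 0)"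
    by (intro sum.cong) (auto simp: alg_elt_def)
  moreover have "(f \<star> alg_elt \<tau>) \<sigma> = (\<Sum>g\<in>Sym n. f g * alg_elt \<tau> (\<sigma> \<circ> inv g))"
    using assms by (simp add: alg_mult_def)
  ultimately show ?thesis using assms by simp
qed

lemma gmult_elt_elt:
  "\<sigma> \<in> Sym n \<Longrightarrow> \<tau> \<in> Sym n \<Longrightarrow> x \<star> alg_elt \<sigma> \<star> alg_elt \<tau> = x \<star> alg_elt (\<tau> \<circ> \<sigma>)"
  by (simp add: gmult_assoc alg_mult_elt)

lemma carrier_eqI:
  assumes "f \<in> alg_carrier n" "h \<in> alg_carrier n" "\<And>\<sigma>. \<sigma> \<in> Sym n \<Longrightarrow> f \<sigma> = h \<sigma>"
  shows "f = h"
  using assms by (force simp: alg_carrier_def fun_eq_iff)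

lemma gmult_id [simp]:
  assumes "f \<in> alg_carrier n"
  shows "alg_elt id \<star> f = f" "f \<star> alg_elt id = f"
  by (rule carrier_eqI, use assms in \<open>auto simp: elt_gmult_apply gmult_elt_apply\<close>)+

lemma carrier_expand:
  assumes "f \<in> alg_carrier n"
  shows "f = (\<Sum>g\<in>Sym n. f g \<cdot> alg_elt g)"
proof (rule ext)
  fix \<sigma>
  have "(\<Sum>g\<in>Sym n. f g \<cdot> alg_elt g) \<sigma> = (\<Sum>g\<in>Sym n. if g = \<sigma> then f \<sigma> else 0)"
    unfolding perm_fun_apply by (rule sum.cong) (auto simp: alg_scale_def alg_elt_def)
  then show "f \<sigma> = (\<Sum>g\<in>Sym n. f g \<cdot> alg_elt g) \<sigma>"
    using assms by (auto simp: alg_carrier_def)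
qed

lemma subspace_carrier: "alg.subspace (alg_carrier n)"
  by (auto simp: alg.subspace_def alg_carrier_def alg_scale_def)

section \<open>Conjugation sums and the centre of the group algebra\<close>

definition avg :: "perm_fun \<Rightarrow> perm_fun" where
  "avg x = (\<Sum>g\<in>Sym n. alg_elt g \<star> x \<star> alg_elt (inv g))"

text \<open>Left multiplication by h permutes the conjugates at the price of one factor h on the
  right. On central elements \<open>avg\<close> is multiplication by n!, so up to this factor it
  projects onto the centre.\<close>

lemma avg_elt_commute:
  assumes h: "h \<in> Sym n"
  shows "alg_elt h \<star> avg x = avg x \<star> alg_elt h"
proof -
  have "alg_elt h \<star> avg x = (\<Sum>g\<in>Sym n. alg_elt (g \<circ> h) \<star> x \<star> alg_elt (inv g))"
    using h by (simp add: avg_def gmult_linear alg_mult_elt flip: gmult_assoc)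
  \<comment> \<open>Rewriting \<open>inv g\<close> as \<open>h \<circ> inv (g \<circ> h)\<close>
    leaves a function of \<open>g \<circ> h\<close> alone, ready for translation.\<close>
  also have "\<dots> = (\<Sum>g\<in>Sym n. alg_elt (g \<circ> h) \<star> x \<star> alg_elt (h \<circ> inv (g \<circ> h)))"
    using h by (intro sum.cong) (auto simp: Sym_inv_comp)
  also have "\<dots> = (\<Sum>g\<in>Sym n. alg_elt g \<star> x \<star> alg_elt (h \<circ> inv g))"
    using sum_Sym_comp_right[OF h, of "\<lambda>g. alg_elt g \<star> x \<star> alg_elt (h \<circ> inv g)"] .
  also have "\<dots> = avg x \<star> alg_elt h"
    using h by (simp add: avg_def gmult_linear gmult_elt_elt)
  finally show ?thesis .
qed

lemma avg_carrier [simp]: "avg x \<in> alg_carrier n"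
  unfolding avg_def by (intro alg.subspace_sum subspace_carrier) simp

lemma avg_central:
  assumes "f \<in> alg_carrier n"
  shows "avg x \<star> f = f \<star> avg x"
proof -
  have "avg x \<star> (\<Sum>g\<in>Sym n. f g \<cdot> alg_elt g) = (\<Sum>g\<in>Sym n. f g \<cdot> alg_elt g) \<star> avg x"
    by (simp add: gmult_linear avg_elt_commute cong: sum.cong)
  then show ?thesis using carrier_expand[OF assms] by simp
qed

lemma avg_linear:
  "avg (c \<cdot> x) = c \<cdot> avg x" "avg (\<Sum>i\<in>I. F i) = (\<Sum>i\<in>I. avg (F i))"
  by (simp_all add: avg_def gmult_linear alg.scale_sum_right sum.swap[of _ "Sym n" I])

text \<open>The two products are conjugate by h: replacing g by \<open>h \<circ> g\<close> in the
  sum passes from one to the other.\<close>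

lemma avg_conj:
  assumes h: "h \<in> Sym n"
  shows "avg (x \<star> alg_elt h) = avg (alg_elt h \<star> x)"
proof -
  have "avg (alg_elt h \<star> x) = (\<Sum>g\<in>Sym n. alg_elt (h \<circ> g) \<star> x \<star> alg_elt (inv (h \<circ> g) \<circ> h))"
    using h unfolding avg_def
    by (intro sum.cong) (auto simp: alg_mult_elt Sym_inv_comp simp flip: gmult_assoc)
  also have "\<dots> = (\<Sum>g\<in>Sym n. alg_elt g \<star> x \<star> alg_elt (inv g \<circ> h))"
    using sum_Sym_comp_left[OF h, of "\<lambda>g. alg_elt g \<star> x \<star> alg_elt (inv g \<circ> h)"] .
  also have "\<dots> = avg (x \<star> alg_elt h)"
    using h by (simp add: avg_def gmult_elt_elt flip: gmult_assoc)
  finally show ?thesis ..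
qed

text \<open>The trace property of \<open>avg\<close>; it allows the row and column factors of a
  Young symmetrizer to change places.\<close>

lemma avg_commute:
  assumes "f \<in> alg_carrier n"
  shows "avg (x \<star> f) = avg (f \<star> x)"
proof -
  have "avg (x \<star> (\<Sum>g\<in>Sym n. f g \<cdot> alg_elt g)) = avg ((\<Sum>g\<in>Sym n. f g \<cdot> alg_elt g) \<star> x)"
    by (simp add: gmult_linear avg_linear avg_conj cong: sum.cong)
  then show ?thesis using carrier_expand[OF assms] by simp
qed

text \<open>Since z slides past every conjugating factor, what is known of z acting on one element
  carries over to its conjugation sum.\<close>

lemma central_gmult_avg:
  assumes "\<And>f. f \<in> alg_carrier n \<Longrightarrow> z \<star> f = f \<star> z"
  shows "z \<star> avg x = avg (z \<star> x)"
  unfolding avg_def gmult_sum_right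
proof (rule sum.cong[OF refl])
  fix g assume g: "g \<in> Sym n"
  have "z \<star> (alg_elt g \<star> x \<star> alg_elt (inv g)) = (z \<star> alg_elt g) \<star> x \<star> alg_elt (inv g)"
    by (simp add: gmult_assoc)
  also have "\<dots> = alg_elt g \<star> (z \<star> x) \<star> alg_elt (inv g)"
    using assms[OF elt_carrier[OF g]] by (simp add: gmult_assoc)
  finally show "z \<star> (alg_elt g \<star> x \<star> alg_elt (inv g)) = alg_elt g \<star> (z \<star> x) \<star> alg_elt (inv g)" .
qed

text \<open>The linear anti-automorphism inverting group elements, without complex conjugation. It
  serves to show that the class sum of a Young symmetrizer takes equal values at g and
  \<open>inv g\<close>, so that its square has a sum of squares at \<open>id\<close>.\<close>

definition star :: "perm_fun \<Rightarrow> perm_fun" where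
  "star f = (\<lambda>\<sigma>. if \<sigma> \<in> Sym n then f (inv \<sigma>) else 0)"

lemma star_gmult: "star (f \<star> h) = star h \<star> star f"
proof
  fix \<sigma>
  show "star (f \<star> h) \<sigma> = (star h \<star> star f) \<sigma>"
  proof (cases "\<sigma> \<in> Sym n")
    case True
    have "(star h \<star> star f) \<sigma> = (\<Sum>g\<in>Sym n. h (inv g) * f (inv (\<sigma> \<circ> inv g)))"
      using True by (simp add: alg_mult_def star_def)
    also have "\<dots> = (\<Sum>g\<in>Sym n. h (inv (g \<circ> \<sigma>)) * f (inv (\<sigma> \<circ> inv (g \<circ> \<sigma>))))"
      using sum_Sym_comp_right[OF True, of "\<lambda>g. h (inv g) * f (inv (\<sigma> \<circ> inv g))"] by simp
    also have "\<dots> = (\<Sum>g\<in>Sym n. f g * h (inv \<sigma> \<circ> inv g))"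
      using True by (intro sum.cong) (auto simp: Sym_inv_comp)
    also have "\<dots> = star (f \<star> h) \<sigma>"
      using True by (simp add: alg_mult_def star_def)
    finally show ?thesis ..
  qed (simp add: alg_mult_def star_def)
qed

lemma star_linear:
  "star (c \<cdot> x) = c \<cdot> star x" "star (\<Sum>i\<in>I. F i) = (\<Sum>i\<in>I. star (F i))"
  by (auto simp: star_def fun_eq_iff perm_fun_apply alg_scale_def)

lemma star_elt: "g \<in> Sym n \<Longrightarrow> star (alg_elt g) = alg_elt (inv g)"
  by (rule carrier_eqI) (auto simp: star_def alg_elt_def alg_carrier_def)

lemma star_avg: "star (avg x) = avg (star x)"
proof -
  have "star (avg x) = (\<Sum>g\<in>Sym n. alg_elt g \<star> star x \<star> alg_elt (inv g))"
    unfolding avg_def star_linear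
    by (intro sum.cong) (auto simp: star_gmult star_elt gmult_assoc)
  then show ?thesis by (simp add: avg_def)
qed

section \<open>Young symmetrizers\<close>

definition row_sum :: "nat set \<Rightarrow> perm_fun" where
  "row_sum P = (\<Sum>r | r permutes P. alg_elt r)"

definition col_sum :: "nat set \<Rightarrow> perm_fun" where
  "col_sum Q = (\<Sum>k | k permutes Q. of_int (sign k) \<cdot> alg_elt k)"

lemma elt_row_sum:
  assumes "P \<subseteq> {1..n}" "r permutes P"
  shows "alg_elt r \<star> row_sum P = row_sum P"
proof -
  have "alg_elt r \<star> row_sum P = (\<Sum>s | s permutes P. alg_elt (s \<circ> r))"
    using assms by (auto simp: row_sum_def gmult_linear alg_mult_elt Sym_subset intro!: sum.cong)
  also have "\<dots> = row_sum P"
    unfolding row_sum_def using assms(2)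
    by (intro sum.reindex_bij_witness[of _ "\<lambda>s. s \<circ> inv r" "\<lambda>s. s \<circ> r"])
      (auto simp: permutes_compose permutes_inv permutes_inv_o simp flip: o_assoc)
  finally show ?thesis .
qed

lemma col_sum_elt:
  assumes "Q \<subseteq> {1..n}" "k permutes Q"
  shows "col_sum Q \<star> alg_elt k = of_int (sign k) \<cdot> col_sum Q"
proof -
  have fin: "finite Q" using assms(1) finite_subset by blast
  have "col_sum Q \<star> alg_elt k =
      (\<Sum>l | l permutes Q. of_int (sign l) \<cdot> alg_elt (k \<circ> l))"
    using assms by (auto simp: col_sum_def gmult_linear alg_mult_elt Sym_subset intro!: sum.cong)
  \<comment> \<open>As signs square to 1, the sign of l is that of k times that of
    \<open>k \<circ> l\<close>.\<close>
  also have "\<dots> = (\<Sum>l | l permutes Q. of_int (sign k) \<cdot> of_int (sign (k \<circ> l)) \<cdot> alg_elt (k \<circ> l))"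
    using assms(2) fin
    by (intro sum.cong) (auto simp: sign_permutes_comp mult.assoc[symmetric])
  also have "\<dots> = (\<Sum>l | l permutes Q. of_int (sign k) \<cdot> of_int (sign l) \<cdot> alg_elt l)"
    using assms(2)
    by (intro sum.reindex_bij_witness[of _ "\<lambda>s. inv k \<circ> s" "\<lambda>s. k \<circ> s"])
      (auto simp: permutes_compose permutes_inv permutes_inv_o o_assoc)
  finally show ?thesis by (simp add: col_sum_def alg.scale_sum_right)
qed

lemma star_row_sum:
  assumes "P \<subseteq> {1..n}"
  shows "star (row_sum P) = row_sum P"
proof -
  have "star (row_sum P) = (\<Sum>s | s permutes P. alg_elt (inv s))"
    using assms by (auto simp: row_sum_def star_linear star_elt Sym_subset intro!: sum.cong)
  also have "\<dots> = row_sum P"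
    unfolding row_sum_def using sum_permutations_inverse[of alg_elt P] by simp
  finally show ?thesis .
qed

lemma star_col_sum:
  assumes "Q \<subseteq> {1..n}"
  shows "star (col_sum Q) = col_sum Q"
proof -
  have fin: "finite Q" using assms(1) finite_subset by blast
  have "star (col_sum Q) = (\<Sum>k | k permutes Q. of_int (sign (inv k)) \<cdot> alg_elt (inv k))"
    unfolding col_sum_def star_linear using assms fin
    by (intro sum.cong) (auto simp: star_elt Sym_subset sign_permutes_inv)
  also have "\<dots> = col_sum Q"
    unfolding col_sum_def
    using sum_permutations_inverse[of "\<lambda>k. of_int (sign k) \<cdot> alg_elt k" Q] by simp
  finally show ?thesis .
qed

lemma row_sum_carrier: "P \<subseteq> {1..n} \<Longrightarrow> row_sum P \<in> alg_carrier n"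
  unfolding row_sum_def
  by (intro alg.subspace_sum subspace_carrier elt_carrier) (auto simp: Sym_subset)

text \<open>The symmetry type of every product of a row sum, an arbitrary element and a column sum.
  Read pointwise, it lets vanishing and uniqueness be decided one permutation at a time, without
  expanding products.\<close>

definition bi_inv :: "nat set \<Rightarrow> nat set \<Rightarrow> perm_fun \<Rightarrow> bool" where
  "bi_inv P Q x \<longleftrightarrow> x \<in> alg_carrier n \<and> (\<forall>r. r permutes P \<longrightarrow> alg_elt r \<star> x = x) \<and>
     (\<forall>k. k permutes Q \<longrightarrow> x \<star> alg_elt k = of_int (sign k) \<cdot> x)"

lemma bi_inv_row_col:
  assumes "P \<subseteq> {1..n}" "Q \<subseteq> {1..n}"
  shows "bi_inv P Q (row_sum P \<star> f \<star> col_sum Q)"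
  using elt_row_sum[OF assms(1)] col_sum_elt[OF assms(2)]
  by (auto simp: bi_inv_def gmult_assoc gmult_linear) (simp flip: gmult_assoc)

lemma bi_inv_apply:
  assumes "P \<subseteq> {1..n}" "Q \<subseteq> {1..n}" and x: "bi_inv P Q x" and \<sigma>: "\<sigma> \<in> Sym n"
  shows "r permutes P \<Longrightarrow> x (\<sigma> \<circ> r) = x \<sigma>"
    and "k permutes Q \<Longrightarrow> x (k \<circ> \<sigma>) = of_int (sign k) * x \<sigma>"
proof -
  assume r: "r permutes P"
  then have "r \<in> Sym n" using assms(1) by (rule Sym_subset)
  then have "(alg_elt r \<star> x) (\<sigma> \<circ> r) = x \<sigma>"
    using \<sigma> by (simp add: elt_gmult_apply)
  then show "x (\<sigma> \<circ> r) = x \<sigma>" using x r by (simp add: bi_inv_def)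
next
  assume k: "k permutes Q"
  then have "k \<in> Sym n" using assms(2) by (rule Sym_subset)
  then have "(x \<star> alg_elt k) (k \<circ> \<sigma>) = x \<sigma>"
    using \<sigma> by (simp add: gmult_elt_apply)
  then have "x \<sigma> = of_int (sign k) * x (k \<circ> \<sigma>)"
    using x k by (simp add: bi_inv_def scale_apply)
  then show "x (k \<circ> \<sigma>) = of_int (sign k) * x \<sigma>"
    by (simp flip: mult.assoc)
qed

text \<open>The two transpositions involved are conjugate under \<open>\<sigma>\<close>.\<close>

lemma bi_inv_eq_0:
  assumes PQ: "P \<subseteq> {1..n}" "Q \<subseteq> {1..n}" and x: "bi_inv P Q x" and \<sigma>: "\<sigma> \<in> Sym n"
    and ij: "i \<in> P" "j \<in> P" "i \<noteq> j" "\<sigma> i \<in> Q" "\<sigma> j \<in> Q"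
  shows "x \<sigma> = 0"
proof -
  have "\<sigma> i \<noteq> \<sigma> j" using Sym_inj[OF \<sigma>] ij by simp
  have "\<sigma> \<circ> transpose i j = transpose (\<sigma> i) (\<sigma> j) \<circ> \<sigma>"
    using Sym_inj[OF \<sigma>] by (auto simp: fun_eq_iff transpose_def)
  then have "x \<sigma> = x (transpose (\<sigma> i) (\<sigma> j) \<circ> \<sigma>)"
    using bi_inv_apply(1)[OF PQ x \<sigma> permutes_swap_id[OF ij(1,2)]] by simp
  also have "\<dots> = - x \<sigma>"
    using bi_inv_apply(2)[OF PQ x \<sigma> permutes_swap_id[OF ij(4,5)]] \<open>\<sigma> i \<noteq> \<sigma> j\<close>
    by (simp add: sign_swap_id)
  finally show ?thesis by simp
qed

text \<open>Inside n points the image of P and the set Q overlap in at least two, so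
  \<open>bi_inv_eq_0\<close> applies at every permutation. P and Q may come from different diagrams,
  which gives orthogonality.\<close>

lemma bi_inv_trivial:
  assumes PQ: "P \<subseteq> {1..n}" "Q \<subseteq> {1..n}" and x: "bi_inv P Q x" and big: "card P + card Q \<ge> n + 2"
  shows "x = 0"
proof (rule carrier_eqI)
  fix \<sigma> assume \<sigma>: "\<sigma> \<in> Sym n"
  have fin: "finite P" "finite Q" using PQ finite_subset by blast+
  have "card (\<sigma> ` P) = card P" by (rule card_image) (auto simp: inj_on_def Sym_inj[OF \<sigma>])
  moreover have "\<sigma> ` P \<union> Q \<subseteq> {1..n}"
  proof -
    have "\<sigma> y \<in> {1..n}" if "y \<in> P" for y using Sym_in_range[OF \<sigma>] that PQ(1) by blast
    then show ?thesis using PQ(2) by blast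
  qed
  then have "card (\<sigma> ` P \<union> Q) \<le> n" using card_mono[of "{1..n}"] by fastforce
  moreover have "card (\<sigma> ` P) + card Q = card (\<sigma> ` P \<union> Q) + card (\<sigma> ` P \<inter> Q)"
    using card_Un_Int[of "\<sigma> ` P" Q] fin by simp
  ultimately have "\<not> card (\<sigma> ` P \<inter> Q) \<le> Suc 0" using big by linarith
  moreover have "finite (\<sigma> ` P \<inter> Q)" using fin by simp
  ultimately obtain a b where ab: "a \<in> \<sigma> ` P \<inter> Q" "b \<in> \<sigma> ` P \<inter> Q" "a \<noteq> b"
    using card_le_Suc0_iff_eq[of "\<sigma> ` P \<inter> Q"] by blast
  then obtain i j where "i \<in> P" "j \<in> P" "a = \<sigma> i" "b = \<sigma> j" by blast
  then show "x \<sigma> = 0 \<sigma>" using bi_inv_eq_0[OF PQ x \<sigma>, of i j] ab by auto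
qed (use x in \<open>auto simp: bi_inv_def alg_carrier_def\<close>)

end

section \<open>Hooks, that is, a row and a column sharing the cell c, and their central
  idempotents\<close>

locale hook =
  fixes n :: nat and P Q :: "nat set" and c :: nat
  assumes PQ_Int: "P \<inter> Q = {c}" and PQ_Un: "P \<union> Q = {1..n}"
begin

lemma P_sub: "P \<subseteq> {1..n}" and Q_sub: "Q \<subseteq> {1..n}" and fin: "finite P" "finite Q"
  and c_in: "c \<in> P" "c \<in> Q"
  using PQ_Un PQ_Int finite_subset[of _ "{1..n}"] by auto

text \<open>Exactly one point of P is sent into Q: none at all would squeeze the image of P into P -
  {c}. Redirecting that point to the corner gives the row factor, and what remains moves only points
  of Q.\<close>

lemma factorization:
  assumes \<sigma>: "\<sigma> \<in> Sym n"
    and inj: "\<And>i j. i \<in> P \<Longrightarrow> j \<in> P \<Longrightarrow> \<sigma> i \<in> Q \<Longrightarrow> \<sigma> j \<in> Q \<Longrightarrow> i = j"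
  obtains k r where "k permutes Q" "r permutes P" "\<sigma> = k \<circ> r"
proof -
  have range: "\<sigma> y \<in> {1..n}" if "y \<in> P" for y using Sym_in_range[OF \<sigma>] that P_sub by blast
  have "\<exists>i\<in>P. \<sigma> i \<in> Q"
  proof (rule ccontr)
    assume "\<not> ?thesis"
    then have "\<sigma> ` P \<subseteq> P - {c}" using range PQ_Un c_in by blast
    moreover have "card (\<sigma> ` P) = card P" by (rule card_image) (auto simp: inj_on_def Sym_inj[OF \<sigma>])
    ultimately have "card P \<le> card (P - {c})" using card_mono[of "P - {c}" "\<sigma> ` P"] fin by simp
    moreover have "card P > 0" using fin c_in by (auto simp: card_gt_0_iff)
    ultimately show False using fin c_in by simp
  qed
  then obtain i where i: "i \<in> P" "\<sigma> i \<in> Q" by blast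
  \<comment> \<open>The exceptional point goes to c, the only cell left free, since all other points
    of P land in P - {c}.\<close>
  define r where "r = (\<lambda>x. if x = i then c else if x \<in> P then \<sigma> x else x)"
  have other: "\<sigma> x \<in> P - {c}" if "x \<in> P" "x \<noteq> i" for x
    using range[OF that(1)] inj[OF that(1) i(1)] that(2) i(2) PQ_Un c_in by blast
  have inj_r: "inj_on r P"
  proof (rule inj_onI)
    fix x y assume "x \<in> P" "y \<in> P" "r x = r y"
    then show "x = y" using other[of x] other[of y] Sym_inj[OF \<sigma>, of x y]
      by (auto simp: r_def split: if_splits)
  qed
  have "r ` P \<subseteq> P" using other i c_in by (auto simp: r_def)
  then have "bij_betw r P P"
    using inj_r fin by (simp add: bij_betw_def endo_inj_surj)
  then have rP: "r permutes P" by (rule bij_imp_permutes) (use i in \<open>auto simp: r_def\<close>)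
  then have rS: "r \<in> Sym n" using P_sub by (rule Sym_subset)
  define k where "k = \<sigma> \<circ> inv r"
  \<comment> \<open>Such x lies in P and differs from c, so its preimage under r is not i, and there
    r agrees with \<sigma>.\<close>
  have "k x = x" if "x \<in> {1..n} - Q" for x
  proof -
    have x: "x \<in> P" "x \<noteq> c" using that PQ_Un c_in by blast+
    have z: "inv r x \<in> P" using permutes_in_image[OF permutes_inv[OF rP]] x by blast
    moreover have "r (inv r x) = x" using rS by simp
    ultimately show ?thesis using x by (auto simp: k_def r_def split: if_splits)
  qed
  moreover have "k permutes {1..n}" using \<sigma> rS by (auto simp: k_def Sym_def permutes_compose permutes_inv)
  ultimately have "k permutes Q" by (meson permutes_superset)
  moreover have "\<sigma> = k \<circ> r" using rS by (simp add: k_def)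
  ultimately show ?thesis using rP that by blast
qed

definition y :: perm_fun where "y = alg_mult n (row_sum P) (col_sum Q)"

lemma bi_inv_y: "bi_inv n P Q y"
  using bi_inv_row_col[OF P_sub Q_sub, of "alg_elt id"] row_sum_carrier[OF P_sub]
  by (simp add: y_def)

lemma y_carrier [simp]: "y \<in> alg_carrier n"
  by (simp add: y_def)

text \<open>The supports of the two factors meet trivially: a permutation of P whose inverse
  permutes Q moves nothing outside {c}. The value 1 lets scalars be read off at
  \<open>id\<close>.\<close>

lemma y_id: "y id = 1"
proof -
  have row: "row_sum P g = (if g permutes P then 1 else 0)" for g
  proof -
    have "row_sum P g = (\<Sum>r | r permutes P. if r = g then 1 else 0)"
      unfolding row_sum_def perm_fun_apply by (rule sum.cong) (auto simp: alg_elt_def)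
    then show ?thesis using fin by (simp add: finite_permutations)
  qed
  have col: "col_sum Q g = (if g permutes Q then of_int (sign g) else 0)" for g
  proof -
    have "col_sum Q g = (\<Sum>k | k permutes Q. if k = g then of_int (sign g) else 0)"
      unfolding col_sum_def perm_fun_apply by (rule sum.cong) (auto simp: alg_elt_def alg_scale_def)
    then show ?thesis using fin by (simp add: finite_permutations)
  qed
  have triv: "g = id" if "g permutes P" "inv g permutes Q" for g
  proof -
    have "g permutes Q" using that permutes_inv by (metis permutes_inv_inv)
    then have "g x = x" if "x \<notin> {c}" for x
      using \<open>g permutes P\<close> that PQ_Int permutes_not_in by (metis IntI)
    then have "g permutes {c}"
      by (intro permutes_superset[OF \<open>g permutes P\<close>]) auto
    then show ?thesis by (simp only: permutes_sing)
  qed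
  have "y id = (\<Sum>g\<in>Sym n. row_sum P g * col_sum Q (inv g))"
    by (simp add: y_def alg_mult_def)
  also have "\<dots> = (\<Sum>g\<in>Sym n. if g = id then 1 else 0)"
    by (rule sum.cong) (use triv in \<open>auto simp: row col permutes_id\<close>)
  finally show ?thesis by simp
qed

text \<open>A permutation either sends two points of P into Q, and both sides vanish there, or it
  factors as k after r, and both are sign k times their value at \<open>id\<close>.\<close>

lemma bi_inv_unique:
  assumes x: "bi_inv n P Q x"
  shows "x = x id \<cdot> y"
proof (rule carrier_eqI)
  fix \<sigma> assume \<sigma>: "\<sigma> \<in> Sym n"
  show "x \<sigma> = (x id \<cdot> y) \<sigma>"
  proof (cases "\<exists>i\<in>P. \<exists>j\<in>P. i \<noteq> j \<and> \<sigma> i \<in> Q \<and> \<sigma> j \<in> Q")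
    case True
    then show ?thesis
      using bi_inv_eq_0[OF P_sub Q_sub _ \<sigma>] x bi_inv_y by (metis mult_zero_right scale_apply)
  next
    case False
    then obtain k r where kr: "k permutes Q" "r permutes P" "\<sigma> = k \<circ> r"
      using factorization[OF \<sigma>] by metis
    have "k \<in> Sym n" using kr(1) Q_sub by (rule Sym_subset)
    have "z \<sigma> = of_int (sign k) * z id" if z: "bi_inv n P Q z" for z
      using bi_inv_apply(1)[OF P_sub Q_sub z \<open>k \<in> Sym n\<close> kr(2)]
        bi_inv_apply(2)[OF P_sub Q_sub z Sym_id kr(1)] kr(3) by simp
    from this[OF x] this[OF bi_inv_y] show ?thesis by (simp add: scale_apply y_id)
  qed
qed (use x in \<open>auto simp: bi_inv_def alg_carrier_def y_def alg_mult_def scale_apply\<close>)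

text \<open>The substitute for Schur's lemma: z can be pushed between the row sum and the column
  sum, so the product keeps the symmetry type, which is one-dimensional.\<close>

lemma central_gmult_y:
  assumes z: "z \<in> alg_carrier n" "\<And>f. f \<in> alg_carrier n \<Longrightarrow> alg_mult n z f = alg_mult n f z"
  shows "\<exists>\<kappa>. alg_mult n z y = \<kappa> \<cdot> y"
proof -
  have "bi_inv n P Q (alg_mult n (row_sum P) (alg_mult n z (col_sum Q)))"
    using bi_inv_row_col[OF P_sub Q_sub, of z] by (simp add: gmult_assoc)
  moreover have "alg_mult n (row_sum P) (alg_mult n z (col_sum Q)) = alg_mult n z y"
    using z(2)[OF row_sum_carrier[OF P_sub]] by (simp add: y_def flip: gmult_assoc)
  ultimately show ?thesis using bi_inv_unique by metis
qed

text \<open>The scalar by which the class sum acts on \<open>y\<close>, extracted as a coefficient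
  at \<open>id\<close> because \<open>y id = 1\<close>. Dividing by it normalises the class sum to
  \<open>C\<close>.\<close>

definition \<kappa> :: complex where "\<kappa> = alg_mult n (avg n y) y id"

lemma avg_y: "alg_mult n (avg n y) y = \<kappa> \<cdot> y"
  using central_gmult_y[OF avg_carrier avg_central]
  by (metis \<kappa>_def mult.right_neutral scale_apply y_id)

text \<open>\<open>star\<close> turns row times column into column times row, and \<open>avg\<close>
  does not see the order.\<close>

lemma avg_symmetric: "star n (avg n y) = avg n y"
proof -
  have "star n (avg n y) = avg n (alg_mult n (col_sum Q) (row_sum P))"
    by (simp add: star_avg y_def star_gmult star_row_sum[OF P_sub] star_col_sum[OF Q_sub])
  also have "\<dots> = avg n y"
    using avg_commute[OF row_sum_carrier[OF P_sub]] by (simp add: y_def)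
  finally show ?thesis .
qed

lemma avg_real: "avg n y \<sigma> \<in> \<real>"
proof -
  have elt: "alg_elt g h \<in> \<real>" for g h by (simp add: alg_elt_def)
  have mult: "alg_mult n f h \<sigma> \<in> \<real>" if "\<And>\<sigma>. f \<sigma> \<in> \<real>" "\<And>\<sigma>. h \<sigma> \<in> \<real>" for f h \<sigma>
    using that by (auto simp: alg_mult_def)
  show ?thesis
    unfolding avg_def y_def row_sum_def col_sum_def
    by (auto simp: perm_fun_apply scale_apply intro!: sum_in_Reals mult Reals_mult elt)
qed

text \<open>Each of the n! conjugates contributes \<open>y id = 1\<close>. This one nonzero value is
  what a vanishing norm would contradict.\<close>

lemma avg_id: "avg n y id = fact n"
proof -
  have "avg n y id = (\<Sum>g\<in>Sym n. 1)"
    unfolding avg_def perm_fun_apply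
    by (rule sum.cong) (auto simp: gmult_elt_apply elt_gmult_apply y_id)
  then show ?thesis by (simp add: card_Sym)
qed

text \<open>Otherwise the real symmetric class function \<open>avg n y\<close> would have square zero, hence
  \<open>\<ell>\<^sup>2\<close>-norm zero.\<close>

lemma \<kappa>_nonzero: "\<kappa> \<noteq> 0"
proof
  assume "\<kappa> = 0"
  let ?e = "avg n y"
  have "alg_mult n ?e ?e = avg n (alg_mult n ?e y)"
    by (rule central_gmult_avg) (rule avg_central)
  also have "\<dots> = 0 \<cdot> avg n y" unfolding avg_y \<open>\<kappa> = 0\<close> by (rule avg_linear)
  also have "\<dots> = 0" by simp
  finally have "alg_mult n ?e ?e = 0" .
  moreover have "alg_mult n ?e ?e id = (\<Sum>g\<in>Sym n. ?e g * ?e g)"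
  proof -
    have "?e (inv g) = ?e g" if "g \<in> Sym n" for g
      using that fun_cong[OF avg_symmetric, of g] by (simp add: star_def)
    then show ?thesis unfolding alg_mult_def by (auto intro!: sum.cong)
  qed
  ultimately have 0: "(\<Sum>g\<in>Sym n. ?e g * ?e g) = 0" by simp
  have "?e g * ?e g = complex_of_real ((Re (?e g))\<^sup>2)" for g
    using avg_real[of g] by (auto simp: Reals_def power2_eq_square)
  then have "complex_of_real (\<Sum>g\<in>Sym n. (Re (?e g))\<^sup>2) = 0" using 0 by simp
  then have "(\<Sum>g\<in>Sym n. (Re (?e g))\<^sup>2) = 0" using of_real_eq_0_iff by blast
  then have "Re (?e id) = 0" by (simp add: sum_nonneg_eq_0_iff)
  then show False by (simp add: avg_id)
qed

definition C :: perm_fun where "C = (1 / \<kappa>) \<cdot> avg n y"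

lemma C_carrier [simp]: "C \<in> alg_carrier n"
  by (simp add: C_def alg.subspace_scale[OF subspace_carrier])

lemma C_central: "f \<in> alg_carrier n \<Longrightarrow> alg_mult n C f = alg_mult n f C"
  by (simp add: C_def gmult_linear avg_central)

lemma C_y: "alg_mult n C y = y"
  using \<kappa>_nonzero by (simp add: C_def gmult_linear avg_y)

lemma C_nonzero: "C \<noteq> 0"
  using C_y y_id by auto

text \<open>The scalar at \<open>y\<close> survives the passage to the class sum. Central elements
  therefore act on \<open>C\<close> by scalars, which makes \<open>C\<close> indecomposable.\<close>

lemma central_gmult_C:
  assumes "\<And>f. f \<in> alg_carrier n \<Longrightarrow> alg_mult n z f = alg_mult n f z"
  shows "alg_mult n z y = \<mu> \<cdot> y \<Longrightarrow> alg_mult n z C = \<mu> \<cdot> C"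
  using central_gmult_avg[OF assms, of y] by (simp add: C_def gmult_linear avg_linear mult.commute)

text \<open>Up to a scalar \<open>C\<close> is the sum of the conjugates of \<open>y\<close>, so it
  kills w as soon as \<open>y\<close> kills every left translate of w.\<close>

lemma C_annihilates:
  assumes "\<And>g. g \<in> Sym n \<Longrightarrow> alg_mult n y (alg_mult n (alg_elt g) w) = 0"
  shows "alg_mult n C w = 0"
proof -
  have "alg_mult n (avg n y) w = 0"
    unfolding avg_def gmult_sum_left
    by (rule sum.neutral) (auto simp: gmult_assoc assms)
  then show ?thesis by (simp add: C_def gmult_linear)
qed

lemma C_central_idempotent: "central_idempotent n C"
proof -
  have "alg_mult n C C = 1 \<cdot> C"
    by (rule central_gmult_C[OF C_central]) (simp_all add: C_y)
  then show ?thesis unfolding central_idempotent_def by (intro conjI ballI C_central) simp_all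
qed

text \<open>p acts on \<open>y\<close> by a scalar, idempotency makes this scalar 0 or 1, and it
  transfers to \<open>C\<close>.\<close>

lemma central_idempotent_dichotomy:
  assumes "central_idempotent n p"
  shows "alg_mult n p C = 0 \<or> alg_mult n p C = C"
proof -
  have p: "p \<in> alg_carrier n" "\<And>f. f \<in> alg_carrier n \<Longrightarrow> alg_mult n p f = alg_mult n f p"
    "alg_mult n p p = p" using assms by (auto simp: central_idempotent_def)
  obtain \<mu> where \<mu>: "alg_mult n p y = \<mu> \<cdot> y" using central_gmult_y p by blast
  have "\<mu> \<cdot> y = alg_mult n (alg_mult n p p) y" using p(3) \<mu> by simp
  also have "\<dots> = (\<mu> * \<mu>) \<cdot> y" by (simp add: gmult_assoc gmult_linear \<mu>)
  finally have "(\<mu> \<cdot> y) id = ((\<mu> * \<mu>) \<cdot> y) id" by (rule fun_cong)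
  then have "\<mu> = 0 \<or> \<mu> = 1" by (simp add: scale_apply y_id)
  then show ?thesis using central_gmult_C[OF p(2) \<mu>] by auto
qed

text \<open>A splitting C = p + q with p q = 0 gives p C = p, while the dichotomy leaves only 0 and
  C for p C.\<close>

lemma C_primitive: "primitive_central_idempotent n C"
  unfolding primitive_central_idempotent_def
proof (intro conjI allI impI C_central_idempotent C_nonzero)
  fix p q assume pq: "central_idempotent n p \<and> central_idempotent n q \<and> alg_mult n p q = 0 \<and> C = p + q"
  then have "alg_mult n p C = p" by (simp add: gmult_linear central_idempotent_def)
  moreover have "alg_mult n p C = 0 \<or> alg_mult n p C = C"
    using central_idempotent_dichotomy pq by blast
  ultimately show "p = 0 \<or> q = 0" using pq by auto
qed

text \<open>z fixes \<open>y\<close>, hence also \<open>C\<close>, so z = C + (z - C) splits z into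
  orthogonal central idempotents; primitivity of z and \<open>C \<noteq> 0\<close> leave z - C =
  0.\<close>

lemma C_unique:
  assumes z: "primitive_central_idempotent n z" and zy: "alg_mult n z y = y"
  shows "z = C"
proof -
  have z': "z \<in> alg_carrier n" "\<And>f. f \<in> alg_carrier n \<Longrightarrow> alg_mult n z f = alg_mult n f z"
    "alg_mult n z z = z"
    using z by (auto simp: primitive_central_idempotent_def central_idempotent_def)
  have zC: "alg_mult n z C = C" using central_gmult_C[OF z'(2), of 1] zy by simp
  then have Cz: "alg_mult n C z = C" using C_central[OF z'(1)] by simp
  have CC: "alg_mult n C C = C" using C_central_idempotent by (simp add: central_idempotent_def)
  have "z - C \<in> alg_carrier n" using z'(1) by (simp add: alg.subspace_diff[OF subspace_carrier])
  moreover have "alg_mult n (z - C) f = alg_mult n f (z - C)" if "f \<in> alg_carrier n" for f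
    unfolding gmult_linear using z'(2)[OF that] C_central[OF that] by simp
  moreover have "alg_mult n (z - C) (z - C) = z - C"
    using zC Cz CC z'(3) by (simp add: gmult_linear)
  ultimately have "central_idempotent n (z - C)"
    unfolding central_idempotent_def by blast
  moreover have "alg_mult n C (z - C) = 0" using Cz CC by (simp add: gmult_linear)
  moreover have "z = C + (z - C)" by simp
  ultimately have "C = 0 \<or> z - C = 0"
    using z C_central_idempotent unfolding primitive_central_idempotent_def by blast
  then show ?thesis using C_nonzero by auto
qed

text \<open>Both halves of the definite description: \<open>C\<close> commutes with f and so fixes
  the left ideal of \<open>y\<close>, and a competitor is tested on \<open>y\<close> alone, itself a
  member of that ideal.\<close>

lemma diagram_idempotent_eq_C:
  assumes "young_symmetrizer n \<mu> = y"
  shows "diagram_idempotent n \<mu> = C"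
  unfolding diagram_idempotent_def
proof (rule the_equality)
  have "alg_mult n C (alg_mult n f y) = alg_mult n f y" if "f \<in> alg_carrier n" for f
    using C_central[OF that] C_y by (metis gmult_assoc)
  then show "primitive_central_idempotent n C \<and> (\<forall>v\<in>irrep n \<mu>. alg_mult n C v = v)"
    using C_primitive assms by (auto simp: irrep_def)
next
  fix z assume z: "primitive_central_idempotent n z \<and> (\<forall>v\<in>irrep n \<mu>. alg_mult n z v = v)"
  have "y \<in> irrep n \<mu>"
    unfolding irrep_def using assms by (auto intro!: exI[of _ "alg_elt id"])
  then show "z = C" using z C_unique by blast
qed

end

section \<open>Hook diagrams\<close>

lemma sum_list_take_hook:
  assumes "1 \<le> m" "m \<le> n"
  shows "sum_list (take (Suc r) (m # replicate (n - m) 1)) = min n (m + r)"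
  using assms by (simp add: sum_list_replicate)

text \<open>Truncated subtraction does the case split: the first m entries all get row 0, the leg
  entries the rows 1, 2 and so on.\<close>

lemma tab_row_hook:
  assumes "1 \<le> m" "m \<le> n" "k \<in> {1..n}"
  shows "tab_row (m # replicate (n - m) 1) k = k - m"
  unfolding tab_row_def sum_list_take_hook[OF assms(1,2)]
  using assms by (intro Least_equality) auto

lemma tab_col_hook:
  assumes "1 \<le> m" "m \<le> n" "k \<in> {1..n}"
  shows "tab_col (m # replicate (n - m) 1) k = (if k \<le> m then k else 1)"
proof (cases "k \<le> m")
  case False
  then obtain r where r: "k - m = Suc r" by (metis Suc_diff_Suc not_le)
  \<comment> \<open>Row \<open>Suc r\<close> is preceded by m + r = k - 1 cells, which places k in
    column 1.\<close>
  have "sum_list (take (k - m) (m # replicate (n - m) 1)) = m + r"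
    unfolding r sum_list_take_hook[OF assms(1,2)] using r assms by auto
  then show ?thesis unfolding tab_col_def tab_row_hook[OF assms] using r False by auto
next
  case True
  then have "tab_row (m # replicate (n - m) 1) k = 0" using tab_row_hook[OF assms] by simp
  then show ?thesis unfolding tab_col_def using True by simp
qed

text \<open>Below the first row every row is a single cell, so its entry is fixed, while the first
  row can be permuted freely.\<close>

lemma row_group_hook:
  assumes "1 \<le> m" "m \<le> n"
  shows "row_group n (m # replicate (n - m) 1) = {r. r permutes {1..m}}"
proof (intro set_eqI iffI)
  fix \<sigma> assume "\<sigma> \<in> row_group n (m # replicate (n - m) 1)"
  then have \<sigma>: "\<sigma> permutes {1..n}" and
    row: "\<And>k. k \<in> {1..n} \<Longrightarrow> tab_row (m # replicate (n - m) 1) (\<sigma> k) = tab_row (m # replicate (n - m) 1) k"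
    by (auto simp: row_group_def Sym_def)
  have "\<sigma> k - m = k - m" if "k \<in> {1..n}" for k
    using row[OF that] tab_row_hook[OF assms that] tab_row_hook[OF assms, of "\<sigma> k"]
      permutes_in_image[OF \<sigma>, of k] that by simp
  then have "\<sigma> k = k" if "k \<in> {1..n} - {1..m}" for k
    using that by (metis DiffD1 DiffD2 atLeastAtMost_iff diff_is_0_eq eq_diff_iff nat_le_linear)
  then show "\<sigma> \<in> {r. r permutes {1..m}}" using permutes_superset[OF \<sigma>] by blast
next
  fix \<sigma> assume "\<sigma> \<in> {r. r permutes {1..m}}"
  then have \<sigma>: "\<sigma> permutes {1..m}" by simp
  have \<sigma>n: "\<sigma> permutes {1..n}" using \<sigma> assms by (auto intro: permutes_subset)
  have "\<sigma> k - m = k - m" for k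
    using permutes_in_image[OF \<sigma>, of k] permutes_not_in[OF \<sigma>, of k]
    by (cases "k \<in> {1..m}") auto
  then show "\<sigma> \<in> row_group n (m # replicate (n - m) 1)"
    using tab_row_hook[OF assms] permutes_in_image[OF \<sigma>n] \<sigma>n
    by (simp add: row_group_def Sym_def del: atLeastAtMost_iff One_nat_def)
qed

text \<open>Columns after the first are single cells; the first consists of the corner 1 and the
  entries greater than m.\<close>

lemma col_group_hook:
  assumes "1 \<le> m" "m \<le> n"
  shows "col_group n (m # replicate (n - m) 1) = {k. k permutes insert 1 {m<..n}}"
proof (intro set_eqI iffI)
  fix \<sigma> assume "\<sigma> \<in> col_group n (m # replicate (n - m) 1)"
  then have \<sigma>: "\<sigma> permutes {1..n}" and
    col: "\<And>k. k \<in> {1..n} \<Longrightarrow> tab_col (m # replicate (n - m) 1) (\<sigma> k) = tab_col (m # replicate (n - m) 1) k"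
    by (auto simp: col_group_def Sym_def)
  have eq: "(if \<sigma> k \<le> m then \<sigma> k else 1) = (if k \<le> m then k else 1)" if "k \<in> {1..n}" for k
    using col[OF that] tab_col_hook[OF assms that] tab_col_hook[OF assms, of "\<sigma> k"]
      permutes_in_image[OF \<sigma>, of k] that by simp
  have "\<sigma> k = k" if "k \<in> {1..n} - insert 1 {m<..n}" for k
    using that eq[of k] by (auto split: if_splits)
  then show "\<sigma> \<in> {k. k permutes insert 1 {m<..n}}" using permutes_superset[OF \<sigma>] by blast
next
  fix \<sigma> assume "\<sigma> \<in> {k. k permutes insert 1 {m<..n}}"
  then have \<sigma>: "\<sigma> permutes insert 1 {m<..n}" by simp
  have "insert 1 {m<..n} \<subseteq> {1..n}" using assms by auto
  then have \<sigma>n: "\<sigma> permutes {1..n}" using \<sigma> permutes_subset by blast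
  have eq: "(if \<sigma> k \<le> m then \<sigma> k else 1) = (if k \<le> m then k else 1)" if "k \<in> {1..n}" for k
    using permutes_in_image[OF \<sigma>, of k] permutes_not_in[OF \<sigma>, of k] that
    by (cases "k \<in> insert 1 {m<..n}") (auto split: if_splits)
  have "tab_col (m # replicate (n - m) 1) (\<sigma> k) = tab_col (m # replicate (n - m) 1) k"
    if k: "k \<in> {1..n}" for k
  proof -
    have "\<sigma> k \<in> {1..n}" using permutes_in_image[OF \<sigma>n] k by blast
    then show ?thesis using eq[OF k] by (simp only: tab_col_hook[OF assms] k)
  qed
  then show "\<sigma> \<in> col_group n (m # replicate (n - m) 1)"
    using \<sigma>n unfolding col_group_def Sym_def by blast
qed

lemma hook_hook: "1 \<le> m \<Longrightarrow> m \<le> n \<Longrightarrow> hook n {1..m} (insert 1 {m<..n}) 1"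
  by unfold_locales auto

lemma young_symmetrizer_hook:
  assumes "1 \<le> m" "m \<le> n"
  shows "young_symmetrizer n (m # replicate (n - m) 1) = hook.y n {1..m} (insert 1 {m<..n})"
  unfolding young_symmetrizer_def hook.y_def[OF hook_hook[OF assms]]
    row_group_hook[OF assms] col_group_hook[OF assms] row_sum_def col_sum_def ..

section \<open>Sign vectors\<close>

text \<open>Passing from a family to its image could lose vectors, so the count rests on
  injectivity. That too follows from the hypothesis: v i = v j is a relation with coefficients 1 and
  -1.\<close>

lemma dim_span_family:
  assumes "finite I" and indep: "\<And>c. (\<Sum>i\<in>I. c i \<cdot> v i) = 0 \<Longrightarrow> \<forall>i\<in>I. c i = 0"
  shows "alg.dim (alg.span (v ` I)) = card I"
proof -
  have inj: "inj_on v I"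
  proof (rule inj_onI, rule ccontr)
    fix i j assume ij: "i \<in> I" "j \<in> I" "v i = v j" "i \<noteq> j"
    define c :: "'a \<Rightarrow> complex" where "c = (\<lambda>k. if k = i then 1 else if k = j then - 1 else 0)"
    have "(\<Sum>k\<in>I. c k \<cdot> v k) = (\<Sum>k\<in>{i, j}. c k \<cdot> v k)"
      by (rule sum.mono_neutral_right) (use assms(1) ij in \<open>auto simp: c_def\<close>)
    also have "\<dots> = 0" using ij by (simp add: c_def)
    finally show False using indep ij(1) by (force simp: c_def)
  qed
  have "alg.independent (v ` I)"
  proof (rule alg.independent_if_scalars_zero)
    fix f x assume "(\<Sum>x\<in>v ` I. f x \<cdot> x) = 0" "x \<in> v ` I"
    then show "f x = 0" using indep[of "f \<circ> v"] inj by (auto simp: sum.reindex)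
  qed (use assms(1) in simp)
  then have "alg.dim (alg.span (v ` I)) = card (v ` I)" by (rule alg.dim_span_eq_card_independent)
  then show ?thesis using inj by (simp add: card_image)
qed

context
  fixes n :: nat
begin

text \<open>For a < b the vector e_ab without its factor 1/sqrt(n!), extended antisymmetrically to
  all ordered pairs and by 0 to equal ones, so that sums may run over the full square of
  indices.\<close>

definition sign_vec :: "nat \<Rightarrow> nat \<Rightarrow> perm_fun" where
  "sign_vec a b = (\<lambda>\<sigma>. if \<sigma> \<in> Sym n then (if \<sigma> a < \<sigma> b then 1 else if \<sigma> b < \<sigma> a then - 1 else 0) else 0)"

definition one_vec :: perm_fun where
  "one_vec = (\<Sum>\<sigma>\<in>Sym n. alg_elt \<sigma>)"

text \<open>Bilinear, without conjugation: these are literally the coefficients that the kernel of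
  the operator produces, for complex f as well.\<close>

definition ip :: "perm_fun \<Rightarrow> perm_fun \<Rightarrow> complex" where
  "ip f h = (\<Sum>\<sigma>\<in>Sym n. f \<sigma> * h \<sigma>)"

lemma one_vec_apply: "one_vec \<sigma> = (if \<sigma> \<in> Sym n then 1 else 0)"
proof -
  have "one_vec \<sigma> = (\<Sum>g\<in>Sym n. if g = \<sigma> then 1 else 0)"
    unfolding one_vec_def perm_fun_apply by (rule sum.cong) (auto simp: alg_elt_def)
  then show ?thesis by simp
qed

lemma sign_vec_carrier [simp]: "sign_vec a b \<in> alg_carrier n"
  by (simp add: alg_carrier_def sign_vec_def)

lemma sign_vec_swap: "sign_vec b a \<sigma> = - sign_vec a b \<sigma>"
  by (auto simp: sign_vec_def)

lemma sign_vec_refl [simp]: "sign_vec a a \<sigma> = 0"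
  by (auto simp: sign_vec_def)

lemma sign_vec_comp: "\<sigma> \<in> Sym n \<Longrightarrow> \<tau> \<in> Sym n \<Longrightarrow> sign_vec a b (\<sigma> \<circ> \<tau>) = sign_vec (\<tau> a) (\<tau> b) \<sigma>"
  by (simp add: sign_vec_def)

lemma sign_vec_square: "\<sigma> \<in> Sym n \<Longrightarrow> a \<noteq> b \<Longrightarrow> sign_vec a b \<sigma> * sign_vec a b \<sigma> = 1"
  using Sym_inj[of \<sigma> n a b] by (auto simp: sign_vec_def)

subsection \<open>The spectral form of the operator\<close>

lemma sum_inversions:
  "(\<Sum>i=1..n. \<Sum>j=1..n. if i < j \<and> h j < h i then 1 else 0 :: complex) = of_nat (inversions n h)"
proof -
  have "(\<Sum>i=1..n. \<Sum>j=1..n. if i < j \<and> h j < h i then 1 else 0 :: complex) =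
      (\<Sum>p\<in>{1..n} \<times> {1..n}. if fst p < snd p \<and> h (snd p) < h (fst p) then 1 else 0)"
    by (simp add: sum.cartesian_product split_beta)
  also have "\<dots> = of_nat (card (({1..n} \<times> {1..n}) \<inter> {p. fst p < snd p \<and> h (snd p) < h (fst p)}))"
    by (simp add: sum.If_cases)
  also have "({1..n} \<times> {1..n}) \<inter> {p. fst p < snd p \<and> h (snd p) < h (fst p)} =
      {(i, j). 1 \<le> i \<and> i < j \<and> j \<le> n \<and> h i > h j}"
    by auto
  finally show ?thesis by (simp add: inversions_def)
qed

lemma sum_reindex_Sym: "g \<in> Sym n \<Longrightarrow> (\<Sum>a=1..n. F (g a)) = (\<Sum>a=1..n. F a)"
  unfolding Sym_def using sum.permute[of g "{1..n}" F] by (simp only: mem_Collect_eq comp_def)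

text \<open>Via g, the inversions of \<open>\<sigma> \<circ> inv g\<close> correspond to the pairs
  that g and \<sigma> order differently. Over all ordered pairs the sign products add up to n(n-1)
  minus 4 per inversion: disagreement lowers a product by 2, and each pair occurs in two
  orders.\<close>

lemma inversions_kernel:
  assumes "g \<in> Sym n" "\<sigma> \<in> Sym n"
  shows "of_nat (inversions n (\<sigma> \<circ> inv g)) =
    of_nat n * (of_nat n - 1) / 4 - (\<Sum>a=1..n. \<Sum>b=1..n. sign_vec a b g * sign_vec a b \<sigma>) / 4"
proof -
  let ?h = "\<sigma> \<circ> inv g"
  have h: "?h \<in> Sym n" using assms by simp
  have "(\<Sum>a=1..n. \<Sum>b=1..n. sign_vec a b g * sign_vec a b \<sigma>) =
      (\<Sum>i=1..n. \<Sum>j=1..n. sign_vec (inv g i) (inv g j) g * sign_vec (inv g i) (inv g j) \<sigma>)"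
    unfolding sum_reindex_Sym[OF Sym_inv[OF assms(1)], of "\<lambda>b. sign_vec _ b g * sign_vec _ b \<sigma>"]
    by (rule sum_reindex_Sym[OF Sym_inv[OF assms(1)],
          of "\<lambda>a. \<Sum>b=1..n. sign_vec a b g * sign_vec a b \<sigma>", symmetric])
  \<comment> \<open>Relabelling positions by \<open>inv g\<close> has turned g into the
    identity.\<close>
  also have "\<dots> = (\<Sum>i=1..n. \<Sum>j=1..n. sign_vec i j id * sign_vec i j ?h)"
    using assms by (intro sum.cong refl) (auto simp: sign_vec_def)
  \<comment> \<open>Off the diagonal the product is 1, lowered by 2 at an inverted pair; the two
    corrections treat the two orders of i and j.\<close>
  also have "\<dots> = (\<Sum>i=1..n. \<Sum>j=1..n. 1 - (if j = i then 1 else 0)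
      - 2 * (if i < j \<and> ?h j < ?h i then 1 else 0) - 2 * (if j < i \<and> ?h i < ?h j then 1 else 0))"
    using h Sym_inj[OF h] by (intro sum.cong refl) (auto simp: sign_vec_def not_less le_less)
  also have "\<dots> = (\<Sum>i=1..n. of_nat n - 1
      - 2 * (\<Sum>j=1..n. if i < j \<and> ?h j < ?h i then 1 else 0)
      - 2 * (\<Sum>j=1..n. if j < i \<and> ?h i < ?h j then 1 else 0))"
    by (intro sum.cong) (auto simp: sum_subtractf sum_distrib_left)
  also have "\<dots> = of_nat n * (of_nat n - 1)
      - 2 * (\<Sum>i=1..n. \<Sum>j=1..n. if i < j \<and> ?h j < ?h i then 1 else 0)
      - 2 * (\<Sum>i=1..n. \<Sum>j=1..n. if j < i \<and> ?h i < ?h j then 1 else 0)"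
    by (simp only: sum_subtractf sum_distrib_left[symmetric] sum_constant) (simp add: algebra_simps)
  also have "(\<Sum>i=1..n. \<Sum>j=1..n. if j < i \<and> ?h i < ?h j then 1 else 0 :: complex) =
      (\<Sum>i=1..n. \<Sum>j=1..n. if i < j \<and> ?h j < ?h i then 1 else 0)"
    by (rule sum.swap)
  finally show ?thesis unfolding sum_inversions by (simp add: comp_def diff_divide_distrib)
qed

lemma u_inv_apply: "h \<in> Sym n \<Longrightarrow> u_inv n h = of_nat (inversions n h)"
proof -
  assume h: "h \<in> Sym n"
  have "u_inv n h = (\<Sum>g\<in>Sym n. if g = h then of_nat (inversions n h) else 0)"
    unfolding u_inv_def perm_fun_apply by (rule sum.cong) (auto simp: alg_elt_def scale_apply)
  then show ?thesis using h by simp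
qed

lemma M_inv_expand:
  "M_inv n f = (of_nat n * (of_nat n - 1) / 4 * ip f one_vec) \<cdot> one_vec
    - (\<Sum>a=1..n. \<Sum>b=1..n. (ip f (sign_vec a b) / 4) \<cdot> sign_vec a b)" (is "?l = ?r")
proof (rule carrier_eqI)
  show "?l \<in> alg_carrier n" by (simp add: M_inv_def)
  show "?r \<in> alg_carrier n" by (simp add: alg_carrier_def perm_fun_apply scale_apply one_vec_apply sign_vec_def)
  fix \<sigma> assume \<sigma>: "\<sigma> \<in> Sym n"
  let ?q = "of_nat n * (of_nat n - 1) / 4 :: complex"
  have "?l \<sigma> = (\<Sum>g\<in>Sym n. f g * of_nat (inversions n (\<sigma> \<circ> inv g)))"
    using \<sigma> by (simp add: M_inv_def alg_mult_def u_inv_apply)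
  also have "\<dots> = (\<Sum>g\<in>Sym n. ?q * f g - (\<Sum>a=1..n. \<Sum>b=1..n. f g * sign_vec a b g / 4 * sign_vec a b \<sigma>))"
    using \<sigma> by (intro sum.cong refl) (simp add: inversions_kernel sum_distrib_left sum_divide_distrib algebra_simps)
  also have "\<dots> = ?q * (\<Sum>g\<in>Sym n. f g) - (\<Sum>g\<in>Sym n. \<Sum>a=1..n. \<Sum>b=1..n. f g * sign_vec a b g / 4 * sign_vec a b \<sigma>)"
    by (simp add: sum_subtractf sum_distrib_left)
  also have "(\<Sum>g\<in>Sym n. \<Sum>a=1..n. \<Sum>b=1..n. f g * sign_vec a b g / 4 * sign_vec a b \<sigma>) =
      (\<Sum>a=1..n. \<Sum>b=1..n. \<Sum>g\<in>Sym n. f g * sign_vec a b g / 4 * sign_vec a b \<sigma>)"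
    by (subst sum.swap, rule sum.cong[OF refl], rule sum.swap)
  also have "\<dots> = (\<Sum>a=1..n. \<Sum>b=1..n. ip f (sign_vec a b) / 4 * sign_vec a b \<sigma>)"
    by (simp add: ip_def sum_distrib_right sum_divide_distrib)
  finally show "?l \<sigma> = ?r \<sigma>"
    using \<sigma> by (simp add: perm_fun_apply scale_apply one_vec_apply ip_def)
qed

subsection \<open>The Gram matrix\<close>

text \<open>Right translation by \<tau> relabels all four indices at once, so for indices in range a
  Gram entry depends only on how they coincide.\<close>

lemma ip_sign_vec_comp:
  assumes "\<tau> \<in> Sym n"
  shows "ip (sign_vec k l) (sign_vec a b) = ip (sign_vec (\<tau> k) (\<tau> l)) (sign_vec (\<tau> a) (\<tau> b))"
proof -
  have "ip (sign_vec k l) (sign_vec a b) = (\<Sum>\<sigma>\<in>Sym n. sign_vec k l (\<sigma> \<circ> \<tau>) * sign_vec a b (\<sigma> \<circ> \<tau>))"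
    unfolding ip_def using sum_Sym_comp_right[OF assms, of "\<lambda>\<sigma>. sign_vec k l \<sigma> * sign_vec a b \<sigma>"] by simp
  then show ?thesis using assms by (simp add: ip_def sign_vec_comp)
qed

lemma ip_sign_vec_swap:
  "ip (sign_vec l k) (sign_vec a b) = - ip (sign_vec k l) (sign_vec a b)"
  "ip (sign_vec k l) (sign_vec b a) = - ip (sign_vec k l) (sign_vec a b)"
  by (simp_all add: ip_def sign_vec_swap[of k l] sign_vec_swap[of a b] sum_negf)

text \<open>Exchanging k and l reverses one factor and leaves the other fixed, so the entry equals
  its negative.\<close>

lemma ip_sign_vec_disjoint:
  assumes "k \<in> {1..n}" "l \<in> {1..n}" "a \<noteq> k" "a \<noteq> l" "b \<noteq> k" "b \<noteq> l"
  shows "ip (sign_vec k l) (sign_vec a b) = 0"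
  using ip_sign_vec_comp[OF Sym_transpose[OF assms(1,2)], of k l a b] ip_sign_vec_swap(1)[of l k a b] assms
  by simp

lemma ip_sign_vec_self: "k \<noteq> l \<Longrightarrow> ip (sign_vec k l) (sign_vec k l) = fact n"
  by (simp add: ip_def sign_vec_square card_Sym)

text \<open>Among three distinct values exactly one is the median, and only there is the product \<open>- 1\<close>.\<close>

lemma sign_vec_triple:
  assumes "\<sigma> \<in> Sym n" "k \<noteq> a" "k \<noteq> b" "a \<noteq> b"
  shows "sign_vec k a \<sigma> * sign_vec k b \<sigma> + sign_vec a k \<sigma> * sign_vec a b \<sigma> +
    sign_vec b a \<sigma> * sign_vec b k \<sigma> = 1"
  using assms Sym_inj[OF assms(1)] by (auto simp: sign_vec_def not_less le_less)

text \<open>Transpositions carry the three choices of the common index among k, a, b into one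
  another, so the three entries agree; by \<open>sign_vec_triple\<close> they add up to n!.\<close>

lemma ip_sign_vec_share:
  assumes "k \<in> {1..n}" "a \<in> {1..n}" "b \<in> {1..n}" "k \<noteq> a" "k \<noteq> b" "a \<noteq> b"
  shows "ip (sign_vec k a) (sign_vec k b) = fact n / 3"
proof -
  let ?T = "ip (sign_vec k a) (sign_vec k b)"
  have "?T = ip (sign_vec a k) (sign_vec a b)" "?T = ip (sign_vec b a) (sign_vec b k)"
    using ip_sign_vec_comp[OF Sym_transpose[OF assms(1,2)], of k a k b]
      ip_sign_vec_comp[OF Sym_transpose[OF assms(1,3)], of k a k b] assms by simp_all
  then have "3 * ?T = ?T + ip (sign_vec a k) (sign_vec a b) + ip (sign_vec b a) (sign_vec b k)"
    by simp
  also have "\<dots> = (\<Sum>\<sigma>\<in>Sym n. 1)"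
    unfolding ip_def sum.distrib[symmetric] using assms by (intro sum.cong refl sign_vec_triple) auto
  finally have "3 * ?T = fact n" by (simp add: card_Sym)
  then have "3 * ?T / 3 = fact n / 3" by (rule arg_cong)
  then show ?thesis by simp
qed

definition \<delta> :: "nat \<Rightarrow> nat \<Rightarrow> complex" where "\<delta> a b = (if a = b then 1 else 0)"

text \<open>Each single delta records one coincidence, worth a third of n!. For equal pairs two
  single terms and one product give three thirds. The formula is antisymmetric in both pairs, so it
  vanishes on degenerate ones, as it should.\<close>

lemma ip_sign_vec:
  assumes "k \<in> {1..n}" "l \<in> {1..n}" "a \<in> {1..n}" "b \<in> {1..n}"
  shows "ip (sign_vec k l) (sign_vec a b) =
    fact n / 3 * (\<delta> k a - \<delta> k b - \<delta> l a + \<delta> l b + \<delta> k a * \<delta> l b - \<delta> k b * \<delta> l a)"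
proof -
  have triv: "ip (sign_vec x x) f = 0" "ip f (sign_vec x x) = 0" for x f by (simp_all add: ip_def)
  consider "k = l \<or> a = b" | "k \<noteq> l" "a \<noteq> b" "k = a" "l = b" | "k \<noteq> l" "a \<noteq> b" "k = b" "l = a"
    | "k \<noteq> l" "a \<noteq> b" "k = a" "l \<noteq> b" | "k \<noteq> l" "a \<noteq> b" "k = b" "l \<noteq> a"
    | "k \<noteq> l" "a \<noteq> b" "l = a" "k \<noteq> b" | "k \<noteq> l" "a \<noteq> b" "l = b" "k \<noteq> a"
    | "k \<noteq> l" "a \<noteq> b" "k \<noteq> a" "k \<noteq> b" "l \<noteq> a" "l \<noteq> b" by blast
  then show ?thesis
  proof cases
    case 1 then show ?thesis by (auto simp: triv \<delta>_def)
  next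
    case 2 then show ?thesis using ip_sign_vec_self[of k l] by (simp add: \<delta>_def)
  next
    case 3 then show ?thesis
      using ip_sign_vec_self[of k l] ip_sign_vec_swap(2)[of k l k l] by (simp add: \<delta>_def)
  next
    case 4 then show ?thesis using ip_sign_vec_share[of k l b] assms by (simp add: \<delta>_def)
  next
    case 5
    then have "ip (sign_vec k l) (sign_vec a k) = - (fact n / 3)"
      using ip_sign_vec_share[of k l a] ip_sign_vec_swap(2)[of k l a k] assms by metis
    then show ?thesis using 5 by (simp add: \<delta>_def)
  next
    case 6
    then have "ip (sign_vec k l) (sign_vec l b) = - (fact n / 3)"
      using ip_sign_vec_share[of l k b] ip_sign_vec_swap(1)[of k l l b] assms by metis
    then show ?thesis using 6 by (simp add: \<delta>_def)
  next
    case 7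
    then have "ip (sign_vec k l) (sign_vec a l) = fact n / 3"
      using ip_sign_vec_share[of l k a] ip_sign_vec_swap(1)[of k l a l] ip_sign_vec_swap(2)[of l k a l] assms
      by simp
    then show ?thesis using 7 by (simp add: \<delta>_def)
  next
    case 8 then show ?thesis using ip_sign_vec_disjoint[of k l a b] assms by (simp add: \<delta>_def)
  qed
qed

lemma sum_\<delta>:
  "k \<in> {1..n} \<Longrightarrow> (\<Sum>a=1..n. \<delta> k a * F a) = F k"
proof -
  assume k: "k \<in> {1..n}"
  have "(\<Sum>a=1..n. \<delta> k a * F a) = (\<Sum>a=1..n. if k = a then F a else 0)"
    by (rule sum.cong) (auto simp: \<delta>_def)
  then show ?thesis using k by simp
qed

text \<open>Contraction of the Gram matrix with an arbitrary F: taking sign vector values at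
  \<sigma> gives the operator, taking the coefficients of a linear relation gives
  independence.\<close>

lemma sum_gram:
  assumes "k \<in> {1..n}" "l \<in> {1..n}"
  shows "(\<Sum>a=1..n. \<Sum>b=1..n. ip (sign_vec k l) (sign_vec a b) * F a b) =
    fact n / 3 * ((\<Sum>b=1..n. F k b) - (\<Sum>b=1..n. F b k) - (\<Sum>b=1..n. F l b) + (\<Sum>b=1..n. F b l)
      + F k l - F l k)"
proof -
  have "(\<Sum>a=1..n. \<Sum>b=1..n. ip (sign_vec k l) (sign_vec a b) * F a b) =
    (\<Sum>a=1..n. \<Sum>b=1..n. fact n / 3 * (\<delta> k a * F a b - \<delta> k b * F a b - \<delta> l a * F a b + \<delta> l b * F a b
      + \<delta> k a * (\<delta> l b * F a b) - \<delta> l a * (\<delta> k b * F a b)))"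
    using assms by (intro sum.cong refl) (simp add: ip_sign_vec algebra_simps)
  also have "\<dots> = fact n / 3 * ((\<Sum>a=1..n. \<delta> k a * (\<Sum>b=1..n. F a b)) - (\<Sum>a=1..n. \<Sum>b=1..n. \<delta> k b * F a b)
      - (\<Sum>a=1..n. \<delta> l a * (\<Sum>b=1..n. F a b)) + (\<Sum>a=1..n. \<Sum>b=1..n. \<delta> l b * F a b)
      + (\<Sum>a=1..n. \<delta> k a * (\<Sum>b=1..n. \<delta> l b * F a b)) - (\<Sum>a=1..n. \<delta> l a * (\<Sum>b=1..n. \<delta> k b * F a b)))"
    by (simp only: sum_distrib_left[symmetric] sum.distrib sum_subtractf)
  also have "\<dots> = fact n / 3 * ((\<Sum>b=1..n. F k b) - (\<Sum>b=1..n. F b k) - (\<Sum>b=1..n. F l b) + (\<Sum>b=1..n. F b l)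
      + F k l - F l k)"
    by (simp only: sum_\<delta>[OF assms(1)] sum_\<delta>[OF assms(2)])
  finally show ?thesis .
qed

text \<open>Only the antisymmetric part d of the coefficients contributes. Pairing with
  \<open>sign_vec k l\<close> gives D k - D l + d k l = 0 for its row sums D, so it suffices that D
  vanishes. This is independence of the vectors with k < l, phrased for sums over the full
  square.\<close>

lemma sign_vec_relation:
  assumes rel: "(\<Sum>a=1..n. \<Sum>b=1..n. c a b \<cdot> sign_vec a b) = 0"
    and k: "k \<in> {1..n}" and l: "l \<in> {1..n}"
  shows "c k l = c l k"
proof -
  define d where "d a b = c a b - c b a" for a b
  define D where "D a = (\<Sum>b=1..n. d a b)" for a
  have eq: "D k - D l + d k l = 0" if k: "k \<in> {1..n}" and l: "l \<in> {1..n}" for k l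
  proof -
    have "0 = ip (sign_vec k l) (\<Sum>a=1..n. \<Sum>b=1..n. c a b \<cdot> sign_vec a b)" by (simp only: rel) (simp add: ip_def)
    also have "\<dots> = (\<Sum>\<sigma>\<in>Sym n. \<Sum>a=1..n. \<Sum>b=1..n. sign_vec k l \<sigma> * sign_vec a b \<sigma> * c a b)"
      by (simp add: ip_def perm_fun_apply scale_apply sum_distrib_left mult_ac)
    also have "\<dots> = (\<Sum>a=1..n. \<Sum>b=1..n. \<Sum>\<sigma>\<in>Sym n. sign_vec k l \<sigma> * sign_vec a b \<sigma> * c a b)"
      by (subst sum.swap, rule sum.cong[OF refl], rule sum.swap)
    also have "\<dots> = (\<Sum>a=1..n. \<Sum>b=1..n. ip (sign_vec k l) (sign_vec a b) * c a b)"
      by (simp add: ip_def sum_distrib_right)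
    also have "\<dots> = fact n / 3 * (D k - D l + d k l)"
      unfolding sum_gram[OF k l] by (simp add: D_def d_def sum_subtractf)
    finally show ?thesis by simp
  qed
  have "(\<Sum>a=1..n. D a) = 0"
    unfolding D_def d_def by (simp add: sum_subtractf) (rule sum.swap)
  \<comment> \<open>Summing over l yields (n + 1) D k: the D l cancel in total, and the last term
    contributes D k once more.\<close>
  have D0: "D k = 0" if k: "k \<in> {1..n}" for k
  proof -
    have "0 = (\<Sum>l=1..n. D k - D l + d k l)" using eq[OF k] by simp
    also have "\<dots> = of_nat n * D k - (\<Sum>l=1..n. D l) + D k"
      by (simp add: sum.distrib sum_subtractf D_def[of k])
    also have "\<dots> = of_nat (Suc n) * D k" using \<open>(\<Sum>a=1..n. D a) = 0\<close> by (simp add: algebra_simps)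
    finally show ?thesis by (metis mult_eq_0_iff of_nat_eq_0_iff nat.distinct(2))
  qed
  show ?thesis using eq[OF k l] D0[OF k] D0[OF l] by (simp add: d_def)
qed

end

section \<open>The eigenspaces\<close>

context
  fixes n :: nat
begin

definition vec_row :: "nat \<Rightarrow> perm_fun" where
  "vec_row k = (\<Sum>b=1..n. sign_vec n k b)"

text \<open>The factor 1/n makes all row sums vanish: the differences of the rows k and l, summed
  over l, give n times row k.\<close>

definition vec_rest :: "nat \<Rightarrow> nat \<Rightarrow> perm_fun" where
  "vec_rest k l = sign_vec n k l - (1 / of_nat n) \<cdot> (vec_row k - vec_row l)"

lemma vec_row_apply: "vec_row k \<sigma> = (\<Sum>b=1..n. sign_vec n k b \<sigma>)"
  by (simp add: vec_row_def perm_fun_apply)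

lemma vec_rest_apply:
  "vec_rest k l \<sigma> = sign_vec n k l \<sigma> - (1 / of_nat n) * (vec_row k \<sigma> - vec_row l \<sigma>)"
  by (simp add: vec_rest_def perm_fun_apply scale_apply)

lemmas vec_apply = vec_rest_apply perm_fun_apply scale_apply

lemma sum_sign_vec_swap: "(\<Sum>b=1..n. sign_vec n b k \<sigma>) = - vec_row k \<sigma>"
  by (simp add: vec_row_apply sign_vec_swap[of n _ k] sum_negf)

lemma sum_vec_row: "(\<Sum>k=1..n. vec_row k \<sigma>) = 0"
proof -
  have "(\<Sum>k=1..n. vec_row k \<sigma>) = (\<Sum>k=1..n. \<Sum>b=1..n. sign_vec n b k \<sigma>)"
    unfolding vec_row_apply by (rule sum.swap)
  also have "\<dots> = - (\<Sum>k=1..n. vec_row k \<sigma>)" unfolding sum_sign_vec_swap by (rule sum_negf)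
  finally show ?thesis by simp
qed

lemma vec_rest_swap: "vec_rest l k = (-1) \<cdot> vec_rest k l"
  by (rule ext) (simp add: vec_apply sign_vec_swap[of n l k] algebra_simps)

lemma vec_rest_refl: "vec_rest k k = 0"
  by (rule ext) (simp add: vec_apply)

lemma sum_vec_rest:
  assumes "n \<ge> 1"
  shows "(\<Sum>l=1..n. vec_rest k l) = 0"
proof (rule ext)
  fix \<sigma>
  have "(\<Sum>l=1..n. vec_rest k l) \<sigma> = (\<Sum>l=1..n. sign_vec n k l \<sigma>)
      - 1 / of_nat n * (of_nat n * vec_row k \<sigma> - (\<Sum>l=1..n. vec_row l \<sigma>))"
    unfolding sum_perm_fun_apply vec_rest_apply sum_subtractf sum_distrib_left[symmetric] by simp
  then show "(\<Sum>l=1..n. vec_rest k l) \<sigma> = 0 \<sigma>"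
    unfolding sum_vec_row vec_row_apply[symmetric] using assms by simp
qed

lemma ip_one_sign_vec:
  assumes "k \<in> {1..n}" "l \<in> {1..n}"
  shows "ip n (sign_vec n k l) (one_vec n) = 0"
proof -
  have "(\<Sum>\<sigma>\<in>Sym n. sign_vec n k l \<sigma>) = (\<Sum>\<sigma>\<in>Sym n. sign_vec n k l (\<sigma> \<circ> transpose k l))"
    using sum_Sym_comp_right[OF Sym_transpose[OF assms], of "sign_vec n k l"] by simp
  also have "\<dots> = (\<Sum>\<sigma>\<in>Sym n. sign_vec n l k \<sigma>)"
    using Sym_transpose[OF assms] by (simp add: sign_vec_comp)
  also have "\<dots> = - (\<Sum>\<sigma>\<in>Sym n. sign_vec n k l \<sigma>)"
    by (simp add: sign_vec_swap[of n l k] sum_negf)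
  finally show ?thesis by (simp add: ip_def one_vec_apply)
qed

lemma M_inv_linear:
  "M_inv n (f + h) = M_inv n f + M_inv n h"
  "M_inv n (f - h) = M_inv n f - M_inv n h"
  "M_inv n (c \<cdot> f) = c \<cdot> M_inv n f"
  "M_inv n (\<Sum>i\<in>I. F i) = (\<Sum>i\<in>I. M_inv n (F i))"
  by (simp_all add: M_inv_def gmult_linear)

text \<open>The kernel contributes -1/4 and the Gram matrix n!/3; the contracted matrix is
  antisymmetric, which doubles every term and leaves -n!/6.\<close>

lemma M_inv_sign_vec:
  assumes "k \<in> {1..n}" "l \<in> {1..n}"
  shows "M_inv n (sign_vec n k l) = (- (fact n / 6)) \<cdot> (sign_vec n k l + vec_row k - vec_row l)"
proof (rule ext)
  fix \<sigma>
  have "M_inv n (sign_vec n k l) \<sigma> =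
      - ((\<Sum>a=1..n. \<Sum>b=1..n. ip n (sign_vec n k l) (sign_vec n a b) * sign_vec n a b \<sigma>) / 4)"
    unfolding M_inv_expand ip_one_sign_vec[OF assms]
    by (simp add: vec_apply sum_divide_distrib)
  also have "\<dots> = - (fact n / 12 * (2 * vec_row k \<sigma> - 2 * vec_row l \<sigma> + 2 * sign_vec n k l \<sigma>))"
    unfolding sum_gram[OF assms] sum_sign_vec_swap vec_row_apply[symmetric]
    by (simp add: sign_vec_swap[of n l k])
  also have "\<dots> = ((- (fact n / 6)) \<cdot> (sign_vec n k l + vec_row k - vec_row l)) \<sigma>"
    by (simp add: perm_fun_apply scale_apply field_simps)
  finally show "M_inv n (sign_vec n k l) \<sigma> =
      ((- (fact n / 6)) \<cdot> (sign_vec n k l + vec_row k - vec_row l)) \<sigma>" .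
qed

definition eig0 :: complex where "eig0 = fact n * (of_nat n * (of_nat n - 1) / 4)"
definition eig1 :: complex where "eig1 = - (fact (n + 1) / 6)"
definition eig2 :: complex where "eig2 = - (fact n / 6)"

lemma M_inv_one_vec: "M_inv n (one_vec n) = eig0 \<cdot> one_vec n"
proof -
  have "ip n (one_vec n) (one_vec n) = fact n"
    by (simp add: ip_def one_vec_apply card_Sym)
  moreover have "ip n (one_vec n) (sign_vec n a b) = 0" if "a \<in> {1..n}" "b \<in> {1..n}" for a b
    using ip_one_sign_vec[OF that] by (simp add: ip_def mult.commute)
  ultimately show ?thesis
    unfolding M_inv_expand eig0_def by (simp add: mult.commute)
qed

text \<open>In the sum over b, \<open>vec_row k\<close> arises once from the sign vectors and n
  times from the constant term, while the \<open>vec_row b\<close> cancel. Hence n + 1 times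
  -n!/6.\<close>

lemma M_inv_vec_row:
  assumes "k \<in> {1..n}"
  shows "M_inv n (vec_row k) = eig1 \<cdot> vec_row k"
proof (rule ext)
  fix \<sigma>
  have "M_inv n (vec_row k) \<sigma> = (\<Sum>b=1..n. - (fact n / 6) * (sign_vec n k b \<sigma> + vec_row k \<sigma> - vec_row b \<sigma>))"
    unfolding vec_row_def[of k] M_inv_linear(4) perm_fun_apply
    using assms by (intro sum.cong refl) (simp add: M_inv_sign_vec scale_apply vec_apply vec_row_apply)
  also have "\<dots> = - (fact n / 6) * (of_nat n * vec_row k \<sigma> + vec_row k \<sigma>)"
    unfolding sum_distrib_left[symmetric] sum_subtractf sum.distrib sum_vec_row vec_row_apply[of k, symmetric]
    by simp
  also have "\<dots> = (eig1 \<cdot> vec_row k) \<sigma>"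
    by (simp add: scale_apply eig1_def field_simps)
  finally show "M_inv n (vec_row k) \<sigma> = (eig1 \<cdot> vec_row k) \<sigma>" .
qed

text \<open>As eig1 is (n + 1) times eig2, the row difference gets the coefficient eig2 (1 -
  (n+1)/n) = -eig2/n, which reproduces the correction in \<open>vec_rest\<close>.\<close>

lemma M_inv_vec_rest:
  assumes "n \<ge> 1" "k \<in> {1..n}" "l \<in> {1..n}"
  shows "M_inv n (vec_rest k l) = eig2 \<cdot> vec_rest k l"
proof (rule ext)
  fix \<sigma>
  have "M_inv n (vec_rest k l) \<sigma> = - (fact n / 6) * (sign_vec n k l \<sigma> + vec_row k \<sigma> - vec_row l \<sigma>)
      - (1 / of_nat n) * eig1 * (vec_row k \<sigma> - vec_row l \<sigma>)"
    unfolding vec_rest_def M_inv_linear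
    using assms by (simp add: M_inv_sign_vec M_inv_vec_row vec_apply algebra_simps)
  also have "eig1 = - (fact n / 6) * (of_nat n + 1)" by (simp add: eig1_def algebra_simps)
  also have "- (fact n / 6) * (sign_vec n k l \<sigma> + vec_row k \<sigma> - vec_row l \<sigma>)
      - (1 / of_nat n) * (- (fact n / 6) * (of_nat n + 1)) * (vec_row k \<sigma> - vec_row l \<sigma>) =
      - (fact n / 6) * (sign_vec n k l \<sigma> - (1 / of_nat n) * (vec_row k \<sigma> - vec_row l \<sigma>))"
    using assms(1) by (simp add: field_simps)
  also have "\<dots> = (eig2 \<cdot> vec_rest k l) \<sigma>"
    by (simp add: vec_apply eig2_def)
  finally show "M_inv n (vec_rest k l) \<sigma> = (eig2 \<cdot> vec_rest k l) \<sigma>" .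
qed

section \<open>The eigenspaces for the nonzero eigenvalues\<close>

definition V0 :: "perm_fun set" where "V0 = alg.span {one_vec n}"
definition V1 :: "perm_fun set" where "V1 = alg.span (vec_row ` {1..n})"
definition V2 :: "perm_fun set" where "V2 = alg.span ((\<lambda>(k, l). vec_rest k l) ` ({1..n} \<times> {1..n}))"

lemma subspace_V: "alg.subspace V0" "alg.subspace V1" "alg.subspace V2"
  by (simp_all add: V0_def V1_def V2_def)

lemma vec_row_V1: "k \<in> {1..n} \<Longrightarrow> vec_row k \<in> V1"
  unfolding V1_def by (intro alg.span_base) auto

lemma vec_rest_V2: "k \<in> {1..n} \<Longrightarrow> l \<in> {1..n} \<Longrightarrow> vec_rest k l \<in> V2"
  unfolding V2_def by (intro alg.span_base) auto

lemma one_vec_V0: "one_vec n \<in> V0"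
  unfolding V0_def by (intro alg.span_base) auto

lemma subspace_eigenspace: "alg.subspace (eigenspace n (M_inv n) c)"
  using alg.subspace_add[OF subspace_carrier] alg.subspace_scale[OF subspace_carrier]
    alg.subspace_0[OF subspace_carrier]
  by (auto simp: alg.subspace_def eigenspace_def M_inv_linear alg.scale_right_distrib mult.commute)
    (simp add: M_inv_def)

lemma vec_carrier [simp]:
  "one_vec n \<in> alg_carrier n" "vec_row k \<in> alg_carrier n" "vec_rest k l \<in> alg_carrier n"
  by (simp_all add: alg_carrier_def vec_apply vec_row_apply one_vec_apply sign_vec_def)

lemma V_eigenspace:
  assumes "n \<ge> 1"
  shows "V0 \<subseteq> eigenspace n (M_inv n) eig0" "V1 \<subseteq> eigenspace n (M_inv n) eig1"
    "V2 \<subseteq> eigenspace n (M_inv n) eig2"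
  unfolding V0_def V1_def V2_def
  by (intro alg.span_minimal subspace_eigenspace;
      use assms in \<open>auto simp: eigenspace_def M_inv_one_vec M_inv_vec_row M_inv_vec_rest\<close>)+

lemma sign_vec_decomp: "sign_vec n k l = (1 / of_nat n) \<cdot> (vec_row k - vec_row l) + vec_rest k l"
  by (simp add: vec_rest_def)

lemma M_inv_range: "\<exists>u\<in>V0. \<exists>v\<in>V1. \<exists>w\<in>V2. M_inv n f = u + v + w"
proof -
  let ?c = "\<lambda>a b. ip n f (sign_vec n a b) / 4"
  let ?u = "(of_nat n * (of_nat n - 1) / 4 * ip n f (one_vec n)) \<cdot> one_vec n"
  let ?v = "- (\<Sum>a=1..n. \<Sum>b=1..n. ?c a b \<cdot> (1 / of_nat n) \<cdot> (vec_row a - vec_row b))"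
  let ?w = "- (\<Sum>a=1..n. \<Sum>b=1..n. ?c a b \<cdot> vec_rest a b)"
  have "M_inv n f = ?u - (\<Sum>a=1..n. \<Sum>b=1..n. ?c a b \<cdot> ((1 / of_nat n) \<cdot> (vec_row a - vec_row b) + vec_rest a b))"
    unfolding M_inv_expand sign_vec_decomp[symmetric] ..
  also have "\<dots> = ?u + ?v + ?w"
    by (simp only: alg.scale_right_distrib sum.distrib) simp
  finally have "M_inv n f = ?u + ?v + ?w" .
  moreover have "?u \<in> V0" by (intro alg.subspace_scale subspace_V one_vec_V0)
  moreover have "?v \<in> V1"
    by (intro alg.subspace_neg alg.subspace_sum alg.subspace_scale alg.subspace_diff subspace_V vec_row_V1)
  moreover have "?w \<in> V2"
    by (intro alg.subspace_neg alg.subspace_sum alg.subspace_scale subspace_V vec_rest_V2)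
  ultimately show ?thesis by blast
qed

text \<open>For nonzero c an eigenvector is 1/c times its image, so it lies in the range of the
  operator.\<close>

lemma eigenvector_decomp:
  assumes "M_inv n f = c \<cdot> f" "c \<noteq> 0"
  shows "\<exists>u\<in>V0. \<exists>v\<in>V1. \<exists>w\<in>V2. f = u + v + w"
proof -
  obtain u v w where uvw: "u \<in> V0" "v \<in> V1" "w \<in> V2" "M_inv n f = u + v + w"
    using M_inv_range by blast
  have "f = (1 / c) \<cdot> M_inv n f" using assms by simp
  then have "f = (1 / c) \<cdot> u + (1 / c) \<cdot> v + (1 / c) \<cdot> w"
    using uvw(4) by (simp add: alg.scale_right_distrib)
  then show ?thesis using uvw subspace_V alg.subspace_scale by blast
qed

lemma eigenvalues_distinct:
  assumes "n \<ge> 3"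
  shows "eig0 \<noteq> 0" "eig1 \<noteq> 0" "eig2 \<noteq> 0" "eig0 \<noteq> eig1" "eig0 \<noteq> eig2" "eig1 \<noteq> eig2"
proof -
  let ?t0 = "fact n * (real n * (real n - 1) / 4)" and ?t1 = "- (fact (n + 1) / 6) :: real"
    and ?t2 = "- (fact n / 6) :: real"
  have s: "eig0 = complex_of_real ?t0" "eig1 = complex_of_real ?t1" "eig2 = complex_of_real ?t2"
    by (simp_all add: eig0_def eig1_def eig2_def)
  have "?t0 > 0" "?t2 < 0" using assms by simp_all
  moreover have "?t1 < ?t2" using assms by (simp add: algebra_simps)
  ultimately have "?t0 \<noteq> 0" "?t1 \<noteq> 0" "?t2 \<noteq> 0" "?t0 \<noteq> ?t1" "?t0 \<noteq> ?t2" "?t1 \<noteq> ?t2" by linarith+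
  then show "eig0 \<noteq> 0" "eig1 \<noteq> 0" "eig2 \<noteq> 0" "eig0 \<noteq> eig1" "eig0 \<noteq> eig2" "eig1 \<noteq> eig2"
    unfolding s by (simp_all only: of_real_eq_iff of_real_eq_0_iff not_False_eq_True)
qed

text \<open>Apply the operator twice: the resulting Vandermonde system has only the trivial solution.\<close>

lemma V_independent:
  assumes "n \<ge> 3" "u \<in> V0" "v \<in> V1" "w \<in> V2" "u + v + w = 0"
  shows "u = 0 \<and> v = 0 \<and> w = 0"
proof -
  have ge: "n \<ge> 1" using assms by simp
  have M: "M_inv n u = eig0 \<cdot> u" "M_inv n v = eig1 \<cdot> v" "M_inv n w = eig2 \<cdot> w"
    using V_eigenspace[OF ge] assms by (auto simp: eigenspace_def)
  have M0: "M_inv n 0 = 0" by (simp add: M_inv_def)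
  have "eig0 \<cdot> u + eig1 \<cdot> v + eig2 \<cdot> w = M_inv n (u + v + w)"
    by (simp only: M_inv_linear M)
  then have 1: "eig0 \<cdot> u + eig1 \<cdot> v + eig2 \<cdot> w = 0" using assms(5) M0 by simp
  have "eig0 \<cdot> eig0 \<cdot> u + eig1 \<cdot> eig1 \<cdot> v + eig2 \<cdot> eig2 \<cdot> w = M_inv n (eig0 \<cdot> u + eig1 \<cdot> v + eig2 \<cdot> w)"
    by (simp only: M_inv_linear M)
  then have 2: "eig0 \<cdot> eig0 \<cdot> u + eig1 \<cdot> eig1 \<cdot> v + eig2 \<cdot> eig2 \<cdot> w = 0" using 1 M0 by simp
  have "u x = 0 \<and> v x = 0 \<and> w x = 0" for x
  proof -
    have e: "u x + v x + w x = 0" "eig0 * u x + eig1 * v x + eig2 * w x = 0"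
      "eig0 * (eig0 * u x) + eig1 * (eig1 * v x) + eig2 * (eig2 * w x) = 0"
      using fun_cong[OF assms(5), of x] fun_cong[OF 1, of x] fun_cong[OF 2, of x]
      by (simp_all only: plus_fun_apply zero_fun_apply scale_apply)
    have "(eig0 - eig1) * (eig0 - eig2) * u x = (eig0 * (eig0 * u x) + eig1 * (eig1 * v x) + eig2 * (eig2 * w x))
        - (eig1 + eig2) * (eig0 * u x + eig1 * v x + eig2 * w x) + eig1 * eig2 * (u x + v x + w x)"
      "(eig1 - eig0) * (eig1 - eig2) * v x = (eig0 * (eig0 * u x) + eig1 * (eig1 * v x) + eig2 * (eig2 * w x))
        - (eig0 + eig2) * (eig0 * u x + eig1 * v x + eig2 * w x) + eig0 * eig2 * (u x + v x + w x)"
      by (simp_all add: algebra_simps)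
    then have "u x = 0" "v x = 0"
      using e eigenvalues_distinct[OF assms(1)] by auto
    then show ?thesis using e(1) by simp
  qed
  then show ?thesis by (auto simp: fun_eq_iff)
qed

text \<open>Comparing c f with the image of f leaves the three components multiplied by c minus
  their eigenvalues; independence makes each multiple zero.\<close>

lemma eigenvector_classification:
  assumes "n \<ge> 3" "M_inv n f = c \<cdot> f" "c \<noteq> 0"
  obtains u v w where "u \<in> V0" "v \<in> V1" "w \<in> V2" "f = u + v + w"
    "c \<noteq> eig0 \<Longrightarrow> u = 0" "c \<noteq> eig1 \<Longrightarrow> v = 0" "c \<noteq> eig2 \<Longrightarrow> w = 0"
proof -
  obtain u v w where uvw: "u \<in> V0" "v \<in> V1" "w \<in> V2" "f = u + v + w"
    using eigenvector_decomp[OF assms(2,3)] by blast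
  have ge: "n \<ge> 1" using assms by simp
  have M: "M_inv n u = eig0 \<cdot> u" "M_inv n v = eig1 \<cdot> v" "M_inv n w = eig2 \<cdot> w"
    using V_eigenspace[OF ge] uvw by (auto simp: eigenspace_def)
  have "c \<cdot> (u + v + w) = eig0 \<cdot> u + eig1 \<cdot> v + eig2 \<cdot> w"
    using assms(2) unfolding uvw(4) M_inv_linear M by simp
  then have "(c - eig0) \<cdot> u + (c - eig1) \<cdot> v + (c - eig2) \<cdot> w = 0"
    by (simp add: alg.scale_left_diff_distrib alg.scale_right_distrib diff_add_eq add_diff_eq diff_eq_eq)
  then have "(c - eig0) \<cdot> u = 0 \<and> (c - eig1) \<cdot> v = 0 \<and> (c - eig2) \<cdot> w = 0"
    using V_independent[OF assms(1)] uvw subspace_V alg.subspace_scale by blast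
  then have "c \<noteq> eig0 \<Longrightarrow> u = 0" "c \<noteq> eig1 \<Longrightarrow> v = 0" "c \<noteq> eig2 \<Longrightarrow> w = 0" by auto
  then show ?thesis using that uvw by blast
qed

lemma eigenspace_eq:
  assumes "n \<ge> 3"
  shows "eigenspace n (M_inv n) eig0 = V0" "eigenspace n (M_inv n) eig1 = V1"
    "eigenspace n (M_inv n) eig2 = V2"
proof -
  note d = eigenvalues_distinct[OF assms]
  have ge: "n \<ge> 1" using assms by simp
  have "f \<in> V0" if "f \<in> eigenspace n (M_inv n) eig0" for f
    using eigenvector_classification[OF assms, of f eig0] that d by (auto simp: eigenspace_def)
  moreover have "f \<in> V1" if "f \<in> eigenspace n (M_inv n) eig1" for f
    using eigenvector_classification[OF assms, of f eig1] that d by (auto simp: eigenspace_def)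
  moreover have "f \<in> V2" if "f \<in> eigenspace n (M_inv n) eig2" for f
    using eigenvector_classification[OF assms, of f eig2] that d by (auto simp: eigenspace_def)
  ultimately show "eigenspace n (M_inv n) eig0 = V0" "eigenspace n (M_inv n) eig1 = V1"
    "eigenspace n (M_inv n) eig2 = V2"
    using V_eigenspace[OF ge] by blast+
qed

subsection \<open>Dimensions\<close>

lemma dim_V0: "alg.dim V0 = 1"
proof -
  have "one_vec n \<noteq> 0" using one_vec_apply[of n id] by auto
  then have "alg.independent {one_vec n}" by simp
  then show ?thesis unfolding V0_def by (simp add: alg.dim_eq_card_independent)
qed

text \<open>The vectors \<open>vec_row k\<close> sum to zero, so the last is dropped. A relation
  among the others has sign vector coefficients depending on the first index alone; being symmetric,
  they all equal the one at n, which is set to 0.\<close>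

lemma dim_V1:
  assumes "n \<ge> 1"
  shows "alg.dim V1 = n - 1"
proof -
  let ?I = "{1..<n}"
  have N: "{1..n} = insert n ?I" using assms by auto
  have "(\<Sum>k=1..n. vec_row k) = 0" by (rule ext) (simp only: sum_perm_fun_apply sum_vec_row zero_fun_apply)
  then have "vec_row n = - (\<Sum>k\<in>?I. vec_row k)" unfolding N by (simp add: eq_neg_iff_add_eq_0)
  moreover have "- (\<Sum>k\<in>?I. vec_row k) \<in> alg.span (vec_row ` ?I)"
    by (intro alg.span_neg alg.span_sum alg.span_base imageI)
  ultimately have "vec_row n \<in> alg.span (vec_row ` ?I)" by simp
  then have "V1 = alg.span (vec_row ` ?I)" unfolding V1_def N by (simp add: alg.span_redundant)
  also have "alg.dim \<dots> = card ?I"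
  proof (rule dim_span_family)
    fix c :: "nat \<Rightarrow> complex"
    assume c: "(\<Sum>k\<in>?I. c k \<cdot> vec_row k) = 0"
    define c' where "c' k = (if k < n then c k else 0)" for k
    have "(\<Sum>a=1..n. \<Sum>b=1..n. c' a \<cdot> sign_vec n a b) = (\<Sum>a=1..n. c' a \<cdot> vec_row a)"
      by (simp add: vec_row_def alg.scale_sum_right)
    also have "\<dots> = (\<Sum>k\<in>?I. c k \<cdot> vec_row k)"
      unfolding N by (simp add: c'_def)
    finally have "c' k = c' n" if "k \<in> ?I" for k
      using sign_vec_relation[where n = n and c = "\<lambda>a b. c' a" and k = k and l = n] that assms c by simp
    then show "\<forall>k\<in>?I. c k = 0" by (auto simp: c'_def)
  qed simp
  finally show ?thesis by simp
qed

lemma card_pairs: "card {(k, l). 1 \<le> k \<and> k < l \<and> l < m} = (m - 1) * (m - 2) div (2::nat)"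
proof (induction m)
  case (Suc m)
  have "{(k, l). 1 \<le> k \<and> k < l \<and> l < Suc m} =
      {(k, l). 1 \<le> k \<and> k < l \<and> l < m} \<union> (\<lambda>k. (k, m)) ` {1..<m}" by (auto simp: less_Suc_eq)
  moreover have "finite {(k, l). 1 \<le> k \<and> k < l \<and> l < m}"
    by (rule finite_subset[of _ "{..m} \<times> {..m}"]) auto
  ultimately have "card {(k, l). 1 \<le> k \<and> k < l \<and> l < Suc m} =
      card {(k, l). 1 \<le> k \<and> k < l \<and> l < m} + card ((\<lambda>k. (k, m)) ` {1..<m})"
    by (simp only:) (rule card_Un_disjoint, auto)
  also have "card ((\<lambda>k. (k, m)) ` {1..<m}) = m - 1" by (simp add: card_image inj_on_def)
  finally have *: "card {(k, l). 1 \<le> k \<and> k < l \<and> l < Suc m} = (m - 1) * (m - 2) div 2 + (m - 1)"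
    using Suc by simp
  show ?case
  proof (cases "m \<le> 1")
    case False
    then obtain p where "m = Suc (Suc p)" by (metis One_nat_def Suc_pred not_le zero_less_diff Suc_diff_Suc diff_zero less_trans zero_less_one)
    then show ?thesis unfolding * by simp
  qed (use * in \<open>auto simp: le_Suc_eq\<close>)
qed simp

text \<open>Vanishing row sums express the vectors with index n by the others, and antisymmetry
  leaves the pairs k < l < n. For independence a relation is rewritten in sign vectors, where the
  coefficients must be symmetric.\<close>

lemma dim_V2:
  assumes "n \<ge> 1"
  shows "alg.dim V2 = (n - 1) * (n - 2) div 2"
proof -
  let ?I = "{(k, l). 1 \<le> k \<and> k < l \<and> l < n}" and ?f = "\<lambda>(k, l). vec_rest k l"
  let ?S = "alg.span (?f ` ?I)"
  have finI: "finite ?I" by (rule finite_subset[of _ "{..n} \<times> {..n}"]) auto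
  have N: "{1..n} = insert n {1..<n}" using assms by auto
  have 1: "vec_rest k l \<in> ?S" if "k \<in> {1..<n}" "l \<in> {1..<n}" for k l
  proof -
    have up: "vec_rest k l \<in> ?S" if "1 \<le> k" "k < l" "l < n" for k l
      using that by (intro alg.span_base) force
    consider "k < l" | "l < k" | "k = l" by linarith
    then show ?thesis
    proof cases
      case 2
      then have "(-1) \<cdot> vec_rest l k \<in> ?S" using up that by (intro alg.span_scale) auto
      then show ?thesis by (simp only: vec_rest_swap[of k l])
    qed (use up that in \<open>auto simp: vec_rest_refl alg.span_zero\<close>)
  qed
  have 2: "vec_rest k n \<in> ?S" if "k \<in> {1..<n}" for k
  proof -
    have "vec_rest k n = - (\<Sum>l\<in>{1..<n}. vec_rest k l)"
      using sum_vec_rest[OF assms, of k] unfolding N by (simp add: eq_neg_iff_add_eq_0)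
    then show ?thesis using 1 that by (auto intro!: alg.span_neg alg.span_sum)
  qed
  have 3: "vec_rest n k \<in> ?S" if "k \<in> {1..<n}" for k
    unfolding vec_rest_swap[of n k] by (intro alg.span_scale 2 that)
  have "vec_rest k l \<in> ?S" if "k \<in> {1..n}" "l \<in> {1..n}" for k l
    using that 1 2 3 unfolding N by (auto simp: vec_rest_refl alg.span_zero)
  then have "V2 \<subseteq> ?S" unfolding V2_def by (intro alg.span_minimal) auto
  moreover have "?S \<subseteq> V2" unfolding V2_def by (intro alg.span_mono image_mono) auto
  ultimately have "V2 = ?S" by blast
  moreover have "alg.dim ?S = card ?I"
  proof (rule dim_span_family[OF finI])
    fix c :: "nat \<times> nat \<Rightarrow> complex"
    assume c: "(\<Sum>i\<in>?I. c i \<cdot> ?f i) = 0"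
    define c' where "c' k l = (if (k, l) \<in> ?I then c (k, l) else 0)" for k l
    \<comment> \<open>Row sum minus column sum of the coefficients: up to the factor -1/n, the
      weight with which \<open>vec_row k\<close> enters through the corrections in
      \<open>vec_rest\<close>.\<close>
    define R where "R k = (\<Sum>l=1..n. c' k l) - (\<Sum>l=1..n. c' l k)" for k
    have "(\<Sum>a=1..n. \<Sum>b=1..n. c' a b \<cdot> vec_rest a b) = (\<Sum>i\<in>{1..n}\<times>{1..n}. c' (fst i) (snd i) \<cdot> ?f i)"
      by (simp add: sum.cartesian_product split_beta)
    also have "\<dots> = (\<Sum>i\<in>?I. c' (fst i) (snd i) \<cdot> ?f i)"
      by (rule sum.mono_neutral_right) (auto simp: c'_def)
    also have "\<dots> = (\<Sum>i\<in>?I. c i \<cdot> ?f i)"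
      by (rule sum.cong) (auto simp: c'_def)
    finally have rel: "(\<Sum>a=1..n. \<Sum>b=1..n. c' a b \<cdot> vec_rest a b) = 0" using c by simp
    have "(\<Sum>a=1..n. \<Sum>b=1..n. (c' a b - R a / of_nat n) \<cdot> sign_vec n a b) = 0"
    proof (rule ext)
      fix \<sigma>
      have "(\<Sum>a=1..n. \<Sum>b=1..n. c' a b * (vec_row a \<sigma> - vec_row b \<sigma>)) = (\<Sum>a=1..n. R a * vec_row a \<sigma>)"
      proof -
        have "(\<Sum>a=1..n. \<Sum>b=1..n. c' a b * vec_row b \<sigma>) = (\<Sum>a=1..n. \<Sum>b=1..n. c' b a * vec_row a \<sigma>)"
          by (rule sum.swap)
        then show ?thesis
          by (simp add: R_def right_diff_distrib left_diff_distrib sum_subtractf sum_distrib_right)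
      qed
      then have "(\<Sum>a=1..n. \<Sum>b=1..n. (c' a b - R a / of_nat n) * sign_vec n a b \<sigma>) =
          (\<Sum>a=1..n. \<Sum>b=1..n. c' a b * sign_vec n a b \<sigma>)
          - 1 / of_nat n * (\<Sum>a=1..n. \<Sum>b=1..n. c' a b * (vec_row a \<sigma> - vec_row b \<sigma>))"
        by (simp add: left_diff_distrib sum_subtractf vec_row_apply sum_distrib_left sum_divide_distrib)
      also have "\<dots> = (\<Sum>a=1..n. \<Sum>b=1..n. c' a b * vec_rest a b \<sigma>)"
        by (simp add: vec_rest_apply right_diff_distrib sum_subtractf sum_distrib_left sum_divide_distrib mult_ac)
      also have "\<dots> = 0" using fun_cong[OF rel, of \<sigma>] by (simp add: perm_fun_apply scale_apply)
      finally show "(\<Sum>a=1..n. \<Sum>b=1..n. (c' a b - R a / of_nat n) \<cdot> sign_vec n a b) \<sigma> = 0 \<sigma>"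
        by (simp add: perm_fun_apply scale_apply)
    qed
    then have eq: "c' a b - R a / of_nat n = c' b a - R b / of_nat n" if "a \<in> {1..n}" "b \<in> {1..n}" for a b
      using sign_vec_relation[where n = n and c = "\<lambda>a b. c' a b - R a / of_nat n" and k = a and l = b] that by blast
    \<comment> \<open>At b = n the extended coefficients are 0 in both orders, so symmetry forces
      all R to coincide.\<close>
    have R: "R a = R n" if "a \<in> {1..n}" for a
    proof -
      have "c' a n = 0" "c' n a = 0" using that by (auto simp: c'_def)
      then show ?thesis using eq[OF that, of n] assms by simp
    qed
    show "\<forall>i\<in>?I. c i = 0"
    proof safe
      fix a b assume ab: "1 \<le> a" "a < b" "b < n"
      \<comment> \<open>With equal R the matrix \<open>c'\<close> itself is symmetric, but it is
        supported strictly above the diagonal.\<close>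
      then have "c' a b = c' b a" using eq[of a b] R[of a] R[of b] by simp
      then show "c (a, b) = 0" using ab by (simp add: c'_def)
    qed
  qed
  ultimately show ?thesis by (simp only: card_pairs)
qed

end

section \<open>The isotypic components of the sign vectors\<close>

lemma gmult_span:
  assumes "\<And>s. s \<in> S \<Longrightarrow> alg_mult n z s = c \<cdot> s" and "v \<in> alg.span S"
  shows "alg_mult n z v = c \<cdot> v"
  using assms(2)
proof (induction rule: alg.span_induct_alt)
  case base
  then show ?case by (simp only: gmult_zero alg.scale_zero_right)
next
  case (step a x y)
  have "alg_mult n z (a \<cdot> x + y) = a \<cdot> c \<cdot> x + c \<cdot> y"
    unfolding gmult_linear assms(1)[OF step(1)] step(2) ..
  also have "\<dots> = c \<cdot> (a \<cdot> x + y)"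
    by (simp only: alg.scale_right_distrib alg.scale_left_commute)
  finally show ?case .
qed

text \<open>Left multiplication acts on positions and so relabels the indices, by the inverse
  because the argument becomes \<open>\<sigma> \<circ> inv \<tau>\<close>.\<close>

lemma elt_sign_vec:
  assumes "\<tau> \<in> Sym n"
  shows "alg_mult n (alg_elt \<tau>) (sign_vec n a b) = sign_vec n (inv \<tau> a) (inv \<tau> b)"
  by (rule carrier_eqI[of _ n]) (use assms in \<open>auto simp: elt_gmult_apply sign_vec_comp\<close>)

lemma elt_vec_row:
  assumes "\<tau> \<in> Sym n"
  shows "alg_mult n (alg_elt \<tau>) (vec_row n k) = vec_row n (inv \<tau> k)"
proof (rule ext)
  fix \<sigma>
  have "alg_mult n (alg_elt \<tau>) (vec_row n k) \<sigma> = (\<Sum>b=1..n. sign_vec n (inv \<tau> k) (inv \<tau> b) \<sigma>)"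
    unfolding vec_row_def gmult_linear elt_sign_vec[OF assms] sum_perm_fun_apply ..
  also have "\<dots> = vec_row n (inv \<tau> k) \<sigma>"
    unfolding vec_row_apply by (rule sum_reindex_Sym[OF Sym_inv[OF assms]])
  finally show "alg_mult n (alg_elt \<tau>) (vec_row n k) \<sigma> = vec_row n (inv \<tau> k) \<sigma>" .
qed

lemma elt_vec_rest:
  assumes "\<tau> \<in> Sym n"
  shows "alg_mult n (alg_elt \<tau>) (vec_rest n k l) = vec_rest n (inv \<tau> k) (inv \<tau> l)"
  by (simp add: vec_rest_def gmult_linear elt_sign_vec[OF assms] elt_vec_row[OF assms])

text \<open>Transpositions generate the permutations of Q and the sign is multiplicative, so a sign
  change under each transposition suffices.\<close>

lemma alternating_elt:
  assumes "finite Q" "Q \<subseteq> {1..n}" "w \<in> alg_carrier n"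
    and alt: "\<And>a b. a \<in> Q \<Longrightarrow> b \<in> Q \<Longrightarrow> a \<noteq> b \<Longrightarrow> alg_mult n (alg_elt (transpose a b)) w = - w"
    and k: "k permutes Q"
  shows "alg_mult n (alg_elt k) w = of_int (sign k) \<cdot> w"
  using k assms(1)
proof (induction rule: permutes_induct)
  case id
  then show ?case using gmult_id(1)[OF assms(3)] by (simp only: sign_id of_int_1 alg.scale_one)
next
  case (swap a b p)
  have "p \<in> Sym n" "transpose a b \<in> Sym n"
    using Sym_subset[OF _ assms(2)] Sym_transpose[of a n b] swap assms(2) by blast+
  then have "alg_elt (transpose a b \<circ> p) = alg_mult n (alg_elt p) (alg_elt (transpose a b))"
    by (simp add: alg_mult_elt)
  then have "alg_mult n (alg_elt (transpose a b \<circ> p)) w = alg_mult n (alg_elt p) (- w)"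
    using alt[of a b] swap by (simp add: gmult_assoc)
  also have "\<dots> = - (of_int (sign p) \<cdot> w)"
    using swap gmult_linear(6)[of n "alg_elt p" "-1" w] by simp
  also have "\<dots> = of_int (sign (transpose a b \<circ> p)) \<cdot> w"
    using swap sign_permutes_comp[OF assms(1) permutes_swap_id, of a b p] by (simp add: sign_swap_id)
  finally show ?case .
qed

lemma col_sum_alternating:
  assumes "finite Q" "Q \<subseteq> {1..n}" "w \<in> alg_carrier n"
    and alt: "\<And>a b. a \<in> Q \<Longrightarrow> b \<in> Q \<Longrightarrow> a \<noteq> b \<Longrightarrow> alg_mult n (alg_elt (transpose a b)) w = - w"
  shows "alg_mult n (col_sum Q) w = fact (card Q) \<cdot> w"
proof -
  have "alg_mult n (col_sum Q) w = (\<Sum>k | k permutes Q. 1 \<cdot> w)"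
    unfolding col_sum_def gmult_linear
    by (rule sum.cong) (auto simp: alternating_elt[OF assms])
  also have "\<dots> = (\<Sum>k | k permutes Q. 1) \<cdot> w" by (rule alg.scale_sum_left[symmetric])
  also have "\<dots> = fact (card Q) \<cdot> w" using assms(1) by (simp add: card_permutations)
  finally show ?thesis .
qed

text \<open>As r runs over the permutations of P, the point \<open>inv r i\<close> takes each value
  in P equally often, namely (card P)!/card P times; multiplying out keeps the identity free of
  division.\<close>

lemma sum_permutes_orbit:
  fixes F :: "'a \<Rightarrow> complex"
  assumes "finite P" "i \<in> P"
  shows "of_nat (card P) * (\<Sum>r | r permutes P. F (inv r i)) = fact (card P) * (\<Sum>j\<in>P. F j)"
proof -
  \<comment> \<open>Composing on the right with the transposition of i and j exchanges r i and r
    j.\<close>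
  have indep: "(\<Sum>r | r permutes P. F (r i)) = (\<Sum>r | r permutes P. F (r j))" if "j \<in> P" for j
    by (rule sum.reindex_bij_witness[of _ "\<lambda>r. r \<circ> transpose i j" "\<lambda>r. r \<circ> transpose i j"])
      (use assms that in \<open>auto simp: permutes_compose permutes_swap_id fun_eq_iff\<close>)
  have "of_nat (card P) * (\<Sum>r | r permutes P. F (inv r i)) = (\<Sum>j\<in>P. \<Sum>r | r permutes P. F (r i))"
    using sum_permutations_inverse[of "\<lambda>r. F (r i)" P] by simp
  also have "\<dots> = (\<Sum>j\<in>P. \<Sum>r | r permutes P. F (r j))"
    by (rule sum.cong[OF refl]) (rule indep)
  also have "\<dots> = (\<Sum>r | r permutes P. \<Sum>j\<in>P. F (r j))" by (rule sum.swap)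
  also have "\<dots> = (\<Sum>r | r permutes P. \<Sum>j\<in>P. F j)"
  proof (rule sum.cong[OF refl])
    fix r assume "r \<in> {r. r permutes P}"
    then show "(\<Sum>j\<in>P. F (r j)) = (\<Sum>j\<in>P. F j)"
      using sum.permute[of r P F] by (simp add: comp_def)
  qed
  also have "\<dots> = fact (card P) * (\<Sum>j\<in>P. F j)"
    using assms(1) by (simp add: card_permutations)
  finally show ?thesis .
qed

text \<open>The cyclic sum changes sign with the orientation of the triangle p, q, r, which every
  transposition of two corners reverses.\<close>

lemma cyclic_sum_transpose:
  assumes "p \<noteq> q" "q \<noteq> r" "r \<noteq> p" "a \<in> {r, p, q}" "b \<in> {r, p, q}" "a \<noteq> b"
  shows "sign_vec n (transpose a b p) (transpose a b q) \<sigma> + sign_vec n (transpose a b q) (transpose a b r) \<sigma>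
    + sign_vec n (transpose a b r) (transpose a b p) \<sigma> =
    - (sign_vec n p q \<sigma> + sign_vec n q r \<sigma> + sign_vec n r p \<sigma>)"
  using assms sign_vec_swap[of n p q \<sigma>] sign_vec_swap[of n q r \<sigma>] sign_vec_swap[of n r p \<sigma>]
  by (auto simp: transpose_def)

section \<open>The two hooks (n-1,1) and (n-2,1,1)\<close>

locale hook_pair =
  fixes n :: nat
  assumes n3: "n \<ge> 3"
begin

sublocale one: hook n "{1..n-1}" "insert 1 {n-1<..n}" 1
  using n3 by (intro hook_hook) auto

sublocale two: hook n "{1..n-2}" "insert 1 {n-2<..n}" 1
  using n3 by (intro hook_hook) auto

lemma C1_eq: "C1 n = one.C"
proof -
  have "young_symmetrizer n ((n - 1) # replicate (n - (n - 1)) 1) = one.y"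
    using n3 by (intro young_symmetrizer_hook) auto
  moreover have "replicate (n - (n - 1)) (1 :: nat) = [1]" using n3 by simp
  ultimately show ?thesis unfolding C1_def by (intro one.diagram_idempotent_eq_C) simp
qed

lemma C2_eq: "C2 n = two.C"
proof -
  have "young_symmetrizer n ((n - 2) # replicate (n - (n - 2)) 1) = two.y"
    using n3 by (intro young_symmetrizer_hook) auto
  moreover have "replicate (n - (n - 2)) (1 :: nat) = [1, 1]" using n3 by (simp add: numeral_2_eq_2)
  ultimately show ?thesis unfolding C2_def by (intro two.diagram_idempotent_eq_C) simp
qed

lemma Q1: "insert 1 {n-1<..n} = {1, n}"
  using n3 by auto

lemma Q2: "insert 1 {n-2<..n} = {1, n - 1, n}"
  using n3 by auto

text \<open>\<open>sign_vec n 1 n\<close> alternates under the column {1, n}, so the column sum only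
  rescales it; the row sum then spreads the index 1 over 1, ..., n - 1, which produces a negative
  multiple of \<open>vec_row n n\<close>.\<close>

lemma vec_row_eq_y: obtains w where "vec_row n n = alg_mult n one.y w"
proof -
  let ?w = "sign_vec n 1 n" and ?P = "{1..n-1}"
  have alt: "alg_mult n (alg_elt (transpose a b)) ?w = - ?w"
    if ab: "a \<in> {1, n}" "b \<in> {1, n}" "a \<noteq> b" for a b
  proof -
    have "transpose a b \<in> Sym n" using ab n3 by (intro Sym_transpose) auto
    moreover have "sign_vec n (transpose a b 1) (transpose a b n) = sign_vec n n 1"
      using ab n3 by auto
    ultimately show ?thesis
      by (simp add: elt_sign_vec inv_swap_id) (rule ext, simp add: uminus_perm_fun_apply sign_vec_swap[of n n])
  qed
  have col: "alg_mult n (col_sum {1, n}) ?w = fact (card {1, n}) \<cdot> ?w"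
    by (rule col_sum_alternating) (use n3 alt in auto)
  have nz: "(of_nat (n - 1) :: complex) \<noteq> 0" using n3 by (simp only: of_nat_eq_0_iff)
  have y: "one.y = alg_mult n (row_sum ?P) (col_sum {1, n})"
    using one.y_def by (simp only: Q1)
  \<comment> \<open>The factorial of the column size comes from the alternation, (n-1)!/(n-1) from
    the orbit count.\<close>
  define d :: complex where "d = fact (card {1, n}) * fact (n - 1) / of_nat (n - 1)"
  have "alg_mult n one.y ?w = (- d) \<cdot> vec_row n n"
  proof (rule ext)
    fix \<sigma>
    have "alg_mult n (row_sum ?P) ?w \<sigma> = (\<Sum>r | r permutes ?P. sign_vec n (inv r 1) n \<sigma>)"
      unfolding row_sum_def gmult_linear sum_perm_fun_apply
    proof (rule sum.cong[OF refl])
      fix r assume "r \<in> {r. r permutes ?P}"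
      then have r: "r permutes ?P" by simp
      then have "r \<in> Sym n" by (rule Sym_subset) auto
      moreover have "inv r n = n" using permutes_not_in[OF permutes_inv[OF r], of n] n3 by simp
      ultimately show "alg_mult n (alg_elt r) ?w \<sigma> = sign_vec n (inv r 1) n \<sigma>"
        by (simp add: elt_sign_vec)
    qed
    then have "of_nat (n - 1) * alg_mult n (row_sum ?P) ?w \<sigma> = fact (n - 1) * (\<Sum>j\<in>?P. sign_vec n j n \<sigma>)"
      using sum_permutes_orbit[of ?P 1 "\<lambda>j. sign_vec n j n \<sigma>"] n3 by simp
    also have "(\<Sum>j\<in>?P. sign_vec n j n \<sigma>) = (\<Sum>j=1..n. sign_vec n j n \<sigma>)"
    proof -
      have "{1..n} = insert n ?P" "n \<notin> ?P" using n3 by auto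
      then show ?thesis by simp
    qed
    also have "\<dots> = - vec_row n n \<sigma>" by (rule sum_sign_vec_swap)
    finally have *: "alg_mult n (row_sum ?P) ?w \<sigma> = fact (n - 1) * (- vec_row n n \<sigma>) / of_nat (n - 1)"
      using nz by (metis nonzero_mult_div_cancel_left)
    have "alg_mult n one.y ?w \<sigma> = fact (card {1, n}) * alg_mult n (row_sum ?P) ?w \<sigma>"
      unfolding y gmult_assoc col gmult_linear scale_apply ..
    then show "alg_mult n one.y ?w \<sigma> = ((- d) \<cdot> vec_row n n) \<sigma>"
      unfolding * d_def scale_apply by simp
  qed
  then have "alg_mult n one.y ((- 1 / d) \<cdot> ?w) = (- 1 / d * - d) \<cdot> vec_row n n"
    by (simp only: gmult_scale_right alg.scale_scale)
  moreover have "d \<noteq> 0" using n3 nz by (simp add: d_def del: of_nat_diff)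
  then have "- 1 / d * - d = 1" by simp
  ultimately have "vec_row n n = alg_mult n one.y ((- 1 / d) \<cdot> ?w)" by (simp only: alg.scale_one)
  then show ?thesis by (rule that)
qed

text \<open>The cyclic sum over the column {1, n-1, n} is alternating. Spreading its index 1 over
  the row turns the two terms containing it into row sums, and together with the constant term they
  form a multiple of \<open>vec_rest\<close>.\<close>

lemma vec_rest_eq_y: obtains w where "vec_rest n (n - 1) n = alg_mult n two.y w"
proof -
  let ?p = "n - 1" and ?q = n and ?P = "{1..n-2}" and ?Q = "{1, n - 1, n}"
  let ?w = "sign_vec n ?p ?q + sign_vec n ?q 1 + sign_vec n 1 ?p"
  have alt: "alg_mult n (alg_elt (transpose a b)) ?w = - ?w"
    if ab: "a \<in> ?Q" "b \<in> ?Q" "a \<noteq> b" for a b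
  proof (rule ext)
    fix \<sigma>
    have "transpose a b \<in> Sym n" using ab n3 by (intro Sym_transpose) auto
    then have "alg_mult n (alg_elt (transpose a b)) ?w \<sigma> =
        sign_vec n (transpose a b ?p) (transpose a b ?q) \<sigma> + sign_vec n (transpose a b ?q) (transpose a b 1) \<sigma>
        + sign_vec n (transpose a b 1) (transpose a b ?p) \<sigma>"
      by (simp add: gmult_linear elt_sign_vec inv_swap_id)
    also have "\<dots> = - (sign_vec n ?p ?q \<sigma> + sign_vec n ?q 1 \<sigma> + sign_vec n 1 ?p \<sigma>)"
      by (rule cyclic_sum_transpose) (use ab n3 in auto)
    finally show "alg_mult n (alg_elt (transpose a b)) ?w \<sigma> = (- ?w) \<sigma>"
      by (simp add: uminus_perm_fun_apply)
  qed
  have "?w \<in> alg_carrier n" by (simp add: alg.subspace_add[OF subspace_carrier])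
  then have col: "alg_mult n (col_sum ?Q) ?w = fact (card ?Q) \<cdot> ?w"
    by (intro col_sum_alternating) (use n3 alt in auto)
  have nz: "(of_nat (n - 2) :: complex) \<noteq> 0" using n3 by (simp only: of_nat_eq_0_iff)
  have y: "two.y = alg_mult n (row_sum ?P) (col_sum ?Q)"
    using two.y_def by (simp only: Q2)
  define d :: complex where "d = fact (card ?Q) * fact (n - 2) * of_nat n / of_nat (n - 2)"
  have "alg_mult n two.y ?w = d \<cdot> vec_rest n ?p ?q"
  proof (rule ext)
    fix \<sigma>
    let ?F = "\<lambda>j. sign_vec n ?p ?q \<sigma> + sign_vec n ?q j \<sigma> + sign_vec n j ?p \<sigma>"
    have "alg_mult n (row_sum ?P) ?w \<sigma> = (\<Sum>r | r permutes ?P. ?F (inv r 1))"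
      unfolding row_sum_def gmult_sum_left sum_perm_fun_apply
    proof (rule sum.cong[OF refl])
      fix r assume "r \<in> {r. r permutes ?P}"
      then have r: "r permutes ?P" by simp
      then have "r \<in> Sym n" by (rule Sym_subset) auto
      moreover have "inv r ?p = ?p" "inv r ?q = ?q"
      proof -
        have "?p \<notin> ?P" "?q \<notin> ?P" using n3 by auto
        then show "inv r ?p = ?p" "inv r ?q = ?q"
          using permutes_not_in[OF permutes_inv[OF r]] by blast+
      qed
      ultimately show "alg_mult n (alg_elt r) ?w \<sigma> = ?F (inv r 1)"
        by (simp add: gmult_linear elt_sign_vec)
    qed
    then have "of_nat (n - 2) * alg_mult n (row_sum ?P) ?w \<sigma> = fact (n - 2) * (\<Sum>j\<in>?P. ?F j)"
      using sum_permutes_orbit[of ?P 1 ?F] n3 by simp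
    also have "(\<Sum>j\<in>?P. ?F j) = of_nat n * vec_rest n ?p ?q \<sigma>"
    proof -
      have split: "{1..n} = insert ?p (insert ?q ?P)" "?p \<notin> insert ?q ?P" "?q \<notin> ?P" using n3 by auto
      have "(\<Sum>j=1..n. ?F j) = ?F ?p + ?F ?q + (\<Sum>j\<in>?P. ?F j)"
        unfolding split(1) using split(2,3) by simp
      \<comment> \<open>The cyclic sum degenerates when its third index meets n - 1 or n, so the sum
        over the row extends to all n indices; the constant term thereby occurs n times.\<close>
      moreover have "?F ?p = 0" "?F ?q = 0"
        by (simp_all only: sign_vec_swap[of n ?q ?p \<sigma>] sign_vec_refl add_0_right right_minus)
      ultimately have "(\<Sum>j\<in>?P. ?F j) = (\<Sum>j=1..n. ?F j)" by (simp only: add_0_left)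
      also have "\<dots> = of_nat n * sign_vec n ?p ?q \<sigma> + vec_row n ?q \<sigma> - vec_row n ?p \<sigma>"
        unfolding sum.distrib sum_sign_vec_swap vec_row_apply[symmetric] by simp
      also have "\<dots> = of_nat n * vec_rest n ?p ?q \<sigma>"
        using n3 by (simp add: vec_rest_apply field_simps)
      finally show ?thesis .
    qed
    finally have *: "alg_mult n (row_sum ?P) ?w \<sigma> = fact (n - 2) * (of_nat n * vec_rest n ?p ?q \<sigma>) / of_nat (n - 2)"
      using nz by (metis nonzero_mult_div_cancel_left)
    have "alg_mult n two.y ?w \<sigma> = fact (card ?Q) * alg_mult n (row_sum ?P) ?w \<sigma>"
      unfolding y gmult_assoc col gmult_scale_right scale_apply ..
    then show "alg_mult n two.y ?w \<sigma> = (d \<cdot> vec_rest n ?p ?q) \<sigma>"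
      unfolding * d_def scale_apply by simp
  qed
  moreover have "d \<noteq> 0" using n3 nz by (simp add: d_def del: of_nat_diff)
  ultimately have "vec_rest n ?p ?q = alg_mult n two.y ((1 / d) \<cdot> ?w)"
    by (simp add: gmult_scale_right)
  then show ?thesis by (rule that)
qed

text \<open>Regrouped, the product has the row type of the first diagram and the column type of the
  second; (n - 1) + 3 = n + 2 is exactly the bound in \<open>bi_inv_trivial\<close>.\<close>

lemma y_orthogonal: "alg_mult n one.y (alg_mult n f two.y) = 0"
proof -
  have "alg_mult n one.y (alg_mult n f two.y) = alg_mult n (alg_mult n (row_sum {1..n-1})
      (alg_mult n (col_sum (insert 1 {n-1<..n})) (alg_mult n f (row_sum {1..n-2})))) (col_sum (insert 1 {n-2<..n}))"
    by (simp only: one.y_def two.y_def gmult_assoc)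
  also have "\<dots> = 0"
  proof (rule bi_inv_trivial)
    show "bi_inv n {1..n-1} (insert 1 {n-2<..n}) \<dots>"
      by (rule bi_inv_row_col[OF one.P_sub two.Q_sub])
    show "n + 2 \<le> card {1..n-1} + card (insert 1 {n-2<..n})" unfolding Q2 using n3 by simp
  qed (rule one.P_sub two.Q_sub)+
  finally show ?thesis .
qed

lemma C_one_y_two: "alg_mult n one.C two.y = 0"
  by (rule one.C_annihilates) (rule y_orthogonal)

text \<open>In this order the sizes n - 2 and 2 force no overlap, so the vanishing is transferred
  instead: \<open>one.C\<close> kills \<open>two.y\<close>, hence \<open>two.C\<close>, and it fixes
  \<open>one.y\<close>.\<close>

lemma C_two_y_one: "alg_mult n two.C one.y = 0"
proof -
  have "alg_mult n one.C two.C = 0"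
    using two.central_gmult_C[of one.C 0, OF one.C_central] C_one_y_two by simp
  then have "alg_mult n two.C one.C = 0" using one.C_central[OF two.C_carrier] by simp
  moreover have "alg_mult n two.C one.y = alg_mult n (alg_mult n two.C one.C) one.y"
    unfolding gmult_assoc one.C_y ..
  ultimately show ?thesis by simp
qed

text \<open>z commutes with left translations, the generators are translates of one of them, and
  that one has \<open>one.y\<close> as left factor, on which z acts by c. Applied with c = 1 and c =
  0.\<close>

lemma central_gmult_V1:
  assumes z: "\<And>f. f \<in> alg_carrier n \<Longrightarrow> alg_mult n z f = alg_mult n f z"
    and y: "alg_mult n z one.y = c \<cdot> one.y" and v: "v \<in> V1 n"
  shows "alg_mult n z v = c \<cdot> v"
proof (rule gmult_span)
  show "v \<in> alg.span (vec_row n ` {1..n})" using v by (simp add: V1_def)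
next
  fix s assume "s \<in> vec_row n ` {1..n}"
  then obtain k where k: "k \<in> {1..n}" "s = vec_row n k" by blast
  obtain w where w: "vec_row n n = alg_mult n one.y w" by (rule vec_row_eq_y)
  have \<tau>: "transpose n k \<in> Sym n" using k n3 by (intro Sym_transpose) auto
  then have "alg_mult n (alg_elt (transpose n k)) (vec_row n n) = s"
    using k by (simp add: elt_vec_row inv_swap_id)
  then have s: "s = alg_mult n (alg_elt (transpose n k)) (alg_mult n one.y w)" using w by simp
  have "alg_mult n z s = alg_mult n (alg_elt (transpose n k)) (alg_mult n (alg_mult n z one.y) w)"
    unfolding s using z[OF elt_carrier[OF \<tau>]] by (metis gmult_assoc)
  then show "alg_mult n z s = c \<cdot> s" unfolding s y by (simp add: gmult_linear)
qed

lemma central_gmult_V2: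
  assumes z: "\<And>f. f \<in> alg_carrier n \<Longrightarrow> alg_mult n z f = alg_mult n f z"
    and y: "alg_mult n z two.y = c \<cdot> two.y" and v: "v \<in> V2 n"
  shows "alg_mult n z v = c \<cdot> v"
proof (rule gmult_span)
  show "v \<in> alg.span ((\<lambda>(k, l). vec_rest n k l) ` ({1..n} \<times> {1..n}))" using v by (simp add: V2_def)
next
  fix s assume "s \<in> (\<lambda>(k, l). vec_rest n k l) ` ({1..n} \<times> {1..n})"
  then obtain k l where kl: "k \<in> {1..n}" "l \<in> {1..n}" "s = vec_rest n k l" by auto
  show "alg_mult n z s = c \<cdot> s"
  proof (cases "k = l")
    case True
    then show ?thesis using kl(3) by (simp add: vec_rest_refl)
  next
    case False
    obtain w where w: "vec_rest n (n - 1) n = alg_mult n two.y w" by (rule vec_rest_eq_y)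
    \<comment> \<open>Chosen to send n - 1 to k and n to l: the inner transposition fixes n because
      k and l differ.\<close>
    define \<rho> where "\<rho> = transpose n l \<circ> transpose (n - 1) (transpose n l k)"
    have "transpose n l k \<in> {1..n}" using kl n3 by (auto simp: transpose_def)
    then have \<rho>: "\<rho> \<in> Sym n" using kl n3 unfolding \<rho>_def by (intro Sym_comp Sym_transpose) auto
    have "transpose n l k \<noteq> n" using False by (metis transpose_apply_first transpose_involutory)
    then have "transpose (n - 1) (transpose n l k) n = n"
      using n3 by (intro transpose_apply_other) auto
    then have "\<rho> (n - 1) = k" "\<rho> n = l" by (simp_all add: \<rho>_def)
    then have "alg_mult n (alg_elt (inv \<rho>)) (vec_rest n (n - 1) n) = s"
      using kl \<rho> by (simp add: elt_vec_rest)
    then have s: "s = alg_mult n (alg_elt (inv \<rho>)) (alg_mult n two.y w)" using w by simp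
    have "alg_mult n z s = alg_mult n (alg_elt (inv \<rho>)) (alg_mult n (alg_mult n z two.y) w)"
      unfolding s using z[OF elt_carrier[OF Sym_inv[OF \<rho>]]] by (metis gmult_assoc)
    then show ?thesis unfolding s y by (simp add: gmult_linear)
  qed
qed

lemma C1_action:
  assumes "v \<in> V1 n" "w \<in> V2 n"
  shows "alg_mult n (C1 n) v = v" "alg_mult n (C1 n) w = 0"
proof -
  have "alg_mult n one.C v = 1 \<cdot> v"
    by (rule central_gmult_V1[OF one.C_central]) (simp_all only: one.C_y assms alg.scale_one alg.scale_zero_left)
  moreover have "alg_mult n one.C w = 0 \<cdot> w"
    by (rule central_gmult_V2[OF one.C_central]) (simp_all only: C_one_y_two assms alg.scale_one alg.scale_zero_left)
  ultimately show "alg_mult n (C1 n) v = v" "alg_mult n (C1 n) w = 0" by (simp_all add: C1_eq)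
qed

lemma C2_action:
  assumes "v \<in> V1 n" "w \<in> V2 n"
  shows "alg_mult n (C2 n) v = 0" "alg_mult n (C2 n) w = w"
proof -
  have "alg_mult n two.C v = 0 \<cdot> v"
    by (rule central_gmult_V1[OF two.C_central]) (simp_all only: C_two_y_one assms alg.scale_one alg.scale_zero_left)
  moreover have "alg_mult n two.C w = 1 \<cdot> w"
    by (rule central_gmult_V2[OF two.C_central]) (simp_all only: two.C_y assms alg.scale_one alg.scale_zero_left)
  ultimately show "alg_mult n (C2 n) v = 0" "alg_mult n (C2 n) w = w" by (simp_all add: C2_eq)
qed

section \<open>The span of the sign vectors and its images under the two idempotents\<close>

lemma e_vec_eq:
  assumes "i < j"
  shows "e_vec n i j = (1 / complex_of_real (sqrt (fact n))) \<cdot> sign_vec n i j"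
proof -
  have "(\<Sum>\<sigma>\<in>Sym n. eps i j \<sigma> \<cdot> alg_elt \<sigma>) = (\<Sum>\<sigma>\<in>Sym n. sign_vec n i j \<sigma> \<cdot> alg_elt \<sigma>)"
  proof (rule sum.cong[OF refl])
    fix \<sigma> assume "\<sigma> \<in> Sym n"
    then show "eps i j \<sigma> \<cdot> alg_elt \<sigma> = sign_vec n i j \<sigma> \<cdot> alg_elt \<sigma>"
      using Sym_inj[of \<sigma> n i j] assms by (auto simp: eps_def sign_vec_def)
  qed
  also have "\<dots> = sign_vec n i j" by (rule carrier_expand[OF sign_vec_carrier, symmetric])
  finally show ?thesis by (simp add: e_vec_def)
qed

lemma sign_vec_H:
  assumes "a \<in> {1..n}" "b \<in> {1..n}"
  shows "sign_vec n a b \<in> H_space n"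
proof -
  let ?q = "complex_of_real (sqrt (fact n))"
  have up: "sign_vec n i j \<in> H_space n" if "1 \<le> i" "i < j" "j \<le> n" for i j
  proof -
    have "sign_vec n i j = ?q \<cdot> e_vec n i j" using that by (simp add: e_vec_eq)
    moreover have "?q \<cdot> e_vec n i j \<in> H_space n"
      unfolding H_space_def using that by (intro alg.span_scale alg.span_base) auto
    ultimately show ?thesis by simp
  qed
  have sub: "alg.subspace (H_space n)" by (simp add: H_space_def)
  consider "a < b" | "b < a" | "a = b" by linarith
  then show ?thesis
  proof cases
    case 1
    then show ?thesis using up assms by simp
  next
    case 2
    then have "- sign_vec n b a \<in> H_space n" using up assms by (intro alg.subspace_neg[OF sub]) simp
    moreover have "- sign_vec n b a = sign_vec n a b"
      by (rule ext) (simp only: uminus_perm_fun_apply sign_vec_swap[of n a b])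
    ultimately show ?thesis by simp
  next
    case 3
    have "sign_vec n b b = 0" by (rule ext) simp
    then show ?thesis using 3 alg.subspace_0[OF sub] by simp
  qed
qed

lemma V_subset_H: "V1 n \<subseteq> H_space n" "V2 n \<subseteq> H_space n"
proof -
  have sub: "alg.subspace (H_space n)" by (simp add: H_space_def)
  have row: "vec_row n k \<in> H_space n" if "k \<in> {1..n}" for k
    unfolding vec_row_def by (intro alg.subspace_sum sub sign_vec_H that)
  then show "V1 n \<subseteq> H_space n" unfolding V1_def by (intro alg.span_minimal sub) auto
  have "vec_rest n k l \<in> H_space n" if "k \<in> {1..n}" "l \<in> {1..n}" for k l
    unfolding vec_rest_def by (intro alg.subspace_diff alg.subspace_scale sub sign_vec_H row that)
  then show "V2 n \<subseteq> H_space n" unfolding V2_def by (intro alg.span_minimal sub) auto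
qed

lemma H_decomp:
  assumes "h \<in> H_space n"
  obtains v w where "v \<in> V1 n" "w \<in> V2 n" "h = v + w"
proof -
  let ?A = "vec_row n ` {1..n}" and ?B = "(\<lambda>(k, l). vec_rest n k l) ` ({1..n} \<times> {1..n})"
  have "e_vec n i j \<in> alg.span (?A \<union> ?B)" if "1 \<le> i" "i < j" "j \<le> n" for i j
    unfolding e_vec_eq[OF that(2)] sign_vec_decomp
    by (intro alg.span_scale alg.span_add alg.span_diff alg.span_base) (use that in auto)
  then have "H_space n \<subseteq> alg.span (?A \<union> ?B)"
    unfolding H_space_def by (intro alg.span_minimal) auto
  then have "h \<in> alg.span (?A \<union> ?B)" using assms by blast
  then show ?thesis using that unfolding alg.span_Un V1_def V2_def by blast
qed

lemma H1_eq: "H1 n = V1 n"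
proof
  show "H1 n \<subseteq> V1 n"
  proof
    fix x assume "x \<in> H1 n"
    then obtain h where h: "h \<in> H_space n" "x = alg_mult n (C1 n) h" by (auto simp: H1_def)
    obtain v w where "v \<in> V1 n" "w \<in> V2 n" "h = v + w" using H_decomp[OF h(1)] .
    then show "x \<in> V1 n" using h(2) by (simp add: gmult_add_right C1_action)
  qed
  show "V1 n \<subseteq> H1 n"
  proof
    fix v assume v: "v \<in> V1 n"
    \<comment> \<open>\<open>C1_action\<close> speaks of a pair of vectors; 0 is taken for the one
      in \<open>V2\<close>.\<close>
    then have "v = alg_mult n (C1 n) v" using C1_action(1)[OF _ alg.subspace_0[OF subspace_V(3)]] by simp
    then show "v \<in> H1 n" using v V_subset_H(1) unfolding H1_def by blast
  qed
qed

lemma H2_eq: "H2 n = V2 n"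
proof
  show "H2 n \<subseteq> V2 n"
  proof
    fix x assume "x \<in> H2 n"
    then obtain h where h: "h \<in> H_space n" "x = alg_mult n (C2 n) h" by (auto simp: H2_def)
    obtain v w where "v \<in> V1 n" "w \<in> V2 n" "h = v + w" using H_decomp[OF h(1)] .
    then show "x \<in> V2 n" using h(2) by (simp add: gmult_add_right C2_action)
  qed
  show "V2 n \<subseteq> H2 n"
  proof
    fix w assume w: "w \<in> V2 n"
    then have "w = alg_mult n (C2 n) w" using C2_action(2)[OF alg.subspace_0[OF subspace_V(2)]] by simp
    then show "w \<in> H2 n" using w V_subset_H(2) unfolding H2_def by blast
  qed
qed

end

theorem theorem5:
  fixes n :: nat and s0 s1 s2 :: real
  assumes "n \<ge> 3"
    and "s0 = fact n * (real n * (real n - 1) / 4)"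
    and "s1 = - (fact (n + 1) / 6)"
    and "s2 = - (fact n / 6)"
  shows "{c. c \<noteq> 0 \<and> is_eigenvalue n (M_inv n) c} = complex_of_real ` {s0, s1, s2}
    \<and> card {s0, s1, s2} = 3 \<and> s0 > 0 \<and> s1 < 0 \<and> s2 < 0
    \<and> alg.dim (eigenspace n (M_inv n) (complex_of_real s0)) = 1
    \<and> eigenspace n (M_inv n) (complex_of_real s0) = alg.span {\<Sum>\<sigma>\<in>Sym n. alg_elt \<sigma>}
    \<and> alg.dim (eigenspace n (M_inv n) (complex_of_real s1)) = n - 1
    \<and> eigenspace n (M_inv n) (complex_of_real s1) = H1 n
    \<and> alg.dim (eigenspace n (M_inv n) (complex_of_real s2)) = (n - 1) * (n - 2) div 2
    \<and> eigenspace n (M_inv n) (complex_of_real s2) = H2 n"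
proof -
  interpret hook_pair n by unfold_locales (rule assms(1))
  have ge: "n \<ge> 1" using n3 by simp
  have s: "complex_of_real s0 = eig0 n" "complex_of_real s1 = eig1 n" "complex_of_real s2 = eig2 n"
    by (simp_all add: assms eig0_def eig1_def eig2_def)
  note distinct = eigenvalues_distinct[OF n3]
  have "s0 > 0" "s1 < 0" "s2 < 0" using n3 by (simp_all add: assms(2-4))
  moreover have "s1 \<noteq> s2" "s0 \<noteq> s1" "s0 \<noteq> s2" using distinct(4-6) unfolding s[symmetric] by auto
  ultimately have card: "card {s0, s1, s2} = 3 \<and> s0 > 0 \<and> s1 < 0 \<and> s2 < 0" by simp
  have dims: "alg.dim (V0 n) = 1" "alg.dim (V1 n) = n - 1" "alg.dim (V2 n) = (n - 1) * (n - 2) div 2"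
    using dim_V0 dim_V1[OF ge] dim_V2[OF ge] .
  \<comment> \<open>Positive dimension makes each of the three numbers an actual eigenvalue; for
    \<open>V2\<close> it depends on n \<ge> 3, with dimension 1 at n = 3.\<close>
  have "(n - 1) * (n - 2) div 2 \<ge> 1"
  proof -
    have "2 * 1 \<le> (n - 1) * (n - 2)" using n3 by (intro mult_le_mono) auto
    then show ?thesis by simp
  qed
  then have dim_pos: "alg.dim (V0 n) \<noteq> 0" "alg.dim (V1 n) \<noteq> 0" "alg.dim (V2 n) \<noteq> 0"
    unfolding dims using n3 by auto
  have nonzero: "\<exists>f\<in>V. f \<noteq> 0" if "alg.dim V \<noteq> 0" for V
  proof (rule ccontr)
    assume "\<not> ?thesis"
    then have "V \<subseteq> alg.span {}" by auto
    then show False using alg.dim_le_card[of V "{}"] that by simp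
  qed
  have eig: "is_eigenvalue n (M_inv n) c" if "\<exists>f\<in>eigenspace n (M_inv n) c. f \<noteq> 0" for c
    using that by (auto simp: eigenspace_def is_eigenvalue_def)
  have "c \<in> {eig0 n, eig1 n, eig2 n}" if c: "c \<noteq> 0" "is_eigenvalue n (M_inv n) c" for c
  proof (rule ccontr)
    assume "c \<notin> {eig0 n, eig1 n, eig2 n}"
    moreover obtain f where f: "f \<noteq> 0" "M_inv n f = c \<cdot> f" using c(2) by (auto simp: is_eigenvalue_def)
    ultimately show False using eigenvector_classification[OF n3 f(2) c(1)] by auto
  qed
  moreover have "is_eigenvalue n (M_inv n) (eig0 n)" "is_eigenvalue n (M_inv n) (eig1 n)"
    "is_eigenvalue n (M_inv n) (eig2 n)"
    using nonzero dim_pos eig unfolding eigenspace_eq[OF n3, symmetric] by blast+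
  ultimately have "{c. c \<noteq> 0 \<and> is_eigenvalue n (M_inv n) c} = complex_of_real ` {s0, s1, s2}"
    using distinct(1-3) by (auto simp: s)
  then show ?thesis
    using card dims unfolding s eigenspace_eq[OF n3] H1_eq H2_eq V0_def one_vec_def by blast
qed

end
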